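(* Let $$\alpha = -\gamma_1,\qquad \beta = \frac{\gamma_2}{\gamma_1},\qquad \delta = \left( \frac{\gamma_2}{\gamma_1}\right)^2 - \frac{ \gamma_3}{2 \gamma_1}$$ (so $\alpha\approx 0.072816$, $\beta\approx 0.133080$, $\delta\approx 0.031813$). For every real number $s>1$, $$ \frac{\alpha}{ 1 + \beta (s-1) + \alpha (s-1)^2 } < \zeta'(s) + \frac{1}{(s-1)^2} < \frac{ \alpha}{1+ \beta(s-1) +\delta(s-1)^2}. $$
   Context: $\zeta$ denotes the Riemann zeta function. The Stieltjes constants $\gamma_n$ ($n\geq 0$) are defined by the Laurent expansion of $\zeta$ at $s=1$: $$\zeta(s) = \frac{1}{s-1} + \sum_{n=0}^{\infty}\frac{(-1)^n}{n!}\gamma_n(s-1)^n .$$ Numerically, $\gamma_1 = -0.0728158\ldots$, $\gamma_2=-0.0096903\ldots$, $\gamma_3 = 0.0020538\ldots$. *)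

theory Defs
  imports "HOL-Complex_Analysis.Complex_Analysis"
begin

(* The analytic continuation of the Dirichlet series to the complex plane without 1.  It is unique
   by the identity theorem; the value at the pole is irrelevant and is fixed to 0 only so that
   the description determines a single total function. *)
definition zeta :: "complex \<Rightarrow> complex" where
  "zeta = (THE f. f holomorphic_on (- {1}) \<and>
                  (\<forall>s. Re s > 1 \<longrightarrow> (\<lambda>n. of_nat (Suc n) powr (- s)) sums f s) \<and>
                  f 1 = 0)"

(* has_laurent_expansion describes expansions around 0, hence the shift to h = s - 1. *)
definition stieltjes :: "nat \<Rightarrow> real" where
  "stieltjes = (THE g. (\<lambda>h. zeta (1 + h)) has_laurent_expansion
     (fls_X_inv + fps_to_fls (Abs_fps (\<lambda>n. of_real ((-1) ^ n / fact n * g n)))))"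

end

theory Submission
  imports Defs "HOL-Probability.Distributions"
begin

text \<open>
  Write h = s - 1 and F(h) = \<zeta>'(1 + h) + 1/h^2.  For h > 0 the Dirichlet series gives
  F(h) = 1/h^2 - \<Sum> (ln n / n) exp(-h ln n), so F is the Laplace transform of the signed measure
  t dt - \<Sum> (ln n / n) \<delta>_{ln n} on [0, \<infinity>).  Let A_p (\<open>defect p\<close>) be the (p+1)-fold primitive of
  that measure; its transform is F(h) / h^(p+1).  Hence, for every constant c,

    (F(h) (1 + \<beta> h + c h^2) - \<alpha>) / h^5

  is the Laplace transform of the function \<open>kernel \<alpha> \<beta> c\<close>, which is
  A_4 + \<beta> A_3 + c A_2 - \<alpha> t^4 / 24.
  The upper bound of the theorem follows once this kernel is negative on (0, \<infinity>) for c = \<delta>, the lower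
  bound once it is positive there for c = \<alpha>.  The power h^5 matters: with h^3 or h^4 instead, the
  corresponding function for c = \<delta> still changes sign near t = ln 2, where the measure has its first
  atom.  Each further integration damps the oscillation caused by the atoms.

  The signs come from the growth at infinity.  With c_j = (-1)^(j+1) \<gamma>_{j+1} / j!, the Taylor
  coefficients of F at 0, one has A_p(t) = \<Sum>_{j \<le> p} c_j t^(p-j) / (p-j)! + D_p(t), where D_p
  (\<open>remainder p\<close>) tends to 0 exponentially.  The values of \<alpha>, \<beta> and \<delta> are exactly those for which
  the powers t^4 and t^3 cancel in the kernel and the coefficient of t^2 / 2 becomes \<alpha> (c - \<delta>).  For
  c = \<delta> a linear function with two negative coefficients remains (\<open>kernel_\<delta>_neg_tail\<close>), for c = \<alpha>
  a parabola with leading coefficient \<alpha> (\<alpha> - \<delta>) / 2 > 0 (\<open>kernel_\<alpha>_pos_tail\<close>).  The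
  remainders are small enough from t = ln 3 on; on [0, ln 2] and [ln 2, ln 3] the
  kernel is an explicit polynomial in t.

  Both quantitative inputs are instances of one summation formula, Euler--Maclaurin of order five for
  functions P(ln x - t) / x with a polynomial P (\<open>logpoly_sum_limit\<close>).  Started at the real
  point e^t it bounds D_p(t), because there the summand vanishes to order p; started at 10 it
  encloses \<gamma>_1, ..., \<gamma>_5 with errors between 1e-6 and 1e-4.

  Two links to the definitions remain.  The continuation of \<zeta> to the punctured plane is built from
  a recursion of Landau which expresses (s - 1) (\<zeta>(s) - 1) by its values at s + 1, s + 2, ...
  (\<open>landau_identity\<close>, \<open>zeta_numerator_continuation\<close>).  The Laurent coefficients of \<zeta> agree with the
  limits \<gamma>_k because D_3 is bounded: its Laplace transform then yields
  F(h) = c_0 + c_1 h + c_2 h^2 + O(h^3) as h decreases to 0 (\<open>taylor_dzeta_reg\<close>,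
  \<open>stieltjes_eq_stieltjes_lim\<close>).
\<close>

section \<open>Euler--Maclaurin summation of order five\<close>

text \<open>
  The Bernoulli polynomials divided by k!, for k \<le> 5; larger indices repeat the last one as a default.
\<close>

fun bern :: "nat \<Rightarrow> real \<Rightarrow> real" where
  "bern 0 u = 1"
| "bern (Suc 0) u = u - 1/2"
| "bern (Suc (Suc 0)) u = u^2/2 - u/2 + 1/12"
| "bern (Suc (Suc (Suc 0))) u = u^3/6 - u^2/4 + u/12"
| "bern (Suc (Suc (Suc (Suc 0)))) u = u^4/24 - u^3/12 + u^2/24 - 1/720"
| "bern (Suc (Suc (Suc (Suc (Suc _))))) u = u^5/120 - u^4/48 + u^3/72 - u/720"

lemma bern_eqs:
  "bern 1 u = u - 1/2"
  "bern 2 u = u^2/2 - u/2 + 1/12"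
  "bern 3 u = u^3/6 - u^2/4 + u/12"
  "bern 4 u = u^4/24 - u^3/12 + u^2/24 - 1/720"
  "bern 5 u = u^5/120 - u^4/48 + u^3/72 - u/720"
  by (simp_all add: eval_nat_numeral)

lemma bern_deriv:
  assumes "k < 5"
  shows "(bern (Suc k) has_real_derivative bern k u) (at u)"
proof -
  have [simp]: "bern 0 = (\<lambda>_. 1)" "bern (Suc 0) = (\<lambda>u. u - 1/2)"
    "bern 2 = (\<lambda>u. u^2/2 - u/2 + 1/12)" "bern 3 = (\<lambda>u. u^3/6 - u^2/4 + u/12)"
    "bern 4 = (\<lambda>u. u^4/24 - u^3/12 + u^2/24 - 1/720)"
    "bern 5 = (\<lambda>u. u^5/120 - u^4/48 + u^3/72 - u/720)"
    by (auto simp: fun_eq_iff bern_eqs)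
  consider "k = 0" | "k = 1" | "k = 2" | "k = 3" | "k = 4" using assms by linarith
  then show ?thesis
    by cases (auto intro!: derivative_eq_intros simp: field_simps
        simp flip: numeral_2_eq_2 simp: power2_eq_square power3_eq_cube power4_eq_xxxx)
qed

text \<open>
  In terms of y = u (1 - u), which runs through [0, 1/4], the square of the polynomial is a product
  of two factors that are easy to maximise separately.
\<close>

lemma abs_bern5_le:
  assumes "0 \<le> u" "u \<le> 1"
  shows "\<bar>bern 5 u\<bar> \<le> 1/4200"
proof -
  define y where "y = u * (1 - u)"
  have y0: "0 \<le> y" using assms by (simp add: y_def)
  have y1: "y \<le> 1/4"
    using zero_le_power2[of "u - 1/2"] by (simp add: y_def power2_eq_square algebra_simps)
  have "(120 * bern 5 u)\<^sup>2 = y\<^sup>2 * (1/4 - y) * (y + 1/3)\<^sup>2"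
    by (simp add: bern_eqs y_def) algebra
  also have "\<dots> \<le> 1/432 * (7/12)\<^sup>2"
  proof (intro mult_mono power_mono)
    have "1/432 - y\<^sup>2 * (1/4 - y) = (y - 1/6)\<^sup>2 * (y + 1/12)"
      by (simp add: power2_eq_square algebra_simps)
    then show "y\<^sup>2 * (1/4 - y) \<le> 1/432"
      using y0 by (smt (verit) mult_nonneg_nonneg zero_le_power2 divide_nonneg_nonneg)
  qed (use y0 y1 in auto)
  also have "\<dots> \<le> (1/35)\<^sup>2" by (simp add: power2_eq_square)
  finally have "\<bar>120 * bern 5 u\<bar> \<le> \<bar>1/35\<bar>"
    by (simp only: abs_le_square_iff)
  then show ?thesis by simp
qed

text \<open>
  The boundary terms of the Euler--Maclaurin formula at x, where f j is the j-th derivative of the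
  summand and u the position of x in its unit interval.
\<close>

definition em_bdry :: "(nat \<Rightarrow> real \<Rightarrow> real) \<Rightarrow> real \<Rightarrow> real \<Rightarrow> real" where
  "em_bdry f u x = (\<Sum>j<5. (-1)^j * bern (Suc j) u * f j x)"

text \<open>
  Because each \<open>bern k\<close> is the derivative of \<open>bern (Suc k)\<close>, the derivative of the boundary terms
  telescopes to f 0 plus \<open>bern 5\<close> times the fifth derivative.  So the boundary terms minus a primitive
  of f 0 change by no more than a multiple of any q whose decrease dominates the fifth derivative.
  Working with such a q replaces the remainder integral by a comparison of monotone functions.
\<close>

lemma em_segment:
  fixes f :: "nat \<Rightarrow> real \<Rightarrow> real"
  assumes der: "\<And>i x. i < 5 \<Longrightarrow> a \<le> x \<Longrightarrow> (f i has_real_derivative f (Suc i) x) (at x)"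
    and \<Phi>: "\<And>x. a \<le> x \<Longrightarrow> (\<Phi> has_real_derivative f 0 x) (at x)"
    and q: "\<And>x. a \<le> x \<Longrightarrow> (q has_real_derivative - r x) (at x)"
    and r: "\<And>x. a \<le> x \<Longrightarrow> \<bar>f 5 x\<bar> \<le> r x"
    and n: "n \<le> a" "a \<le> b" "b \<le> n + 1"
  shows "\<bar>(em_bdry f (b - n) b - \<Phi> b) - (em_bdry f (a - n) a - \<Phi> a)\<bar> \<le> (q a - q b) / 4200"
proof -
  define S where "S = (\<lambda>x. em_bdry f (x - n) x - \<Phi> x)"
  have dS: "(S has_real_derivative bern 5 (x - n) * f 5 x) (at x)" if "a \<le> x" for x
  proof -
    have b: "((\<lambda>x. bern (Suc k) (x - n)) has_real_derivative bern k (x - n)) (at x)" if "k < 5" for k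
      using DERIV_chain2[where g = "\<lambda>x. x - n" and x = x and Db = 1 and s = UNIV, OF bern_deriv[OF that]]
      by (simp add: DERIV_diff[where E = 0, simplified])
    have "(S has_real_derivative
        (\<Sum>j<5. (-1)^j * (bern j (x - n) * f j x + f (Suc j) x * bern (Suc j) (x - n))) - f 0 x) (at x)"
      unfolding S_def em_bdry_def mult.assoc using that
      by (intro DERIV_diff DERIV_sum DERIV_cmult DERIV_mult' b der \<Phi>)
         (auto intro!: derivative_eq_intros b der simp: algebra_simps)
    also have "(\<Sum>j<5. (-1)^j * (bern j (x - n) * f j x + f (Suc j) x * bern (Suc j) (x - n))) - f 0 x
        = bern 5 (x - n) * f 5 x"
      by (simp add: eval_nat_numeral del: bern.simps(2-))
    finally show ?thesis .
  qed
  have bd: "\<bar>bern 5 (x - n) * f 5 x\<bar> \<le> r x / 4200" if "a \<le> x" "x \<le> b" for x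
  proof -
    have "\<bar>bern 5 (x - n)\<bar> * \<bar>f 5 x\<bar> \<le> 1/4200 * r x"
      using that n by (intro mult_mono abs_bern5_le r) auto
    then show ?thesis by (simp add: abs_mult)
  qed
  have "q b / 4200 + S b \<le> q a / 4200 + S a"
  proof (rule DERIV_nonpos_imp_nonincreasing[OF n(2)])
    fix x assume x: "a \<le> x" "x \<le> b"
    \<comment> \<open>The bound 1/4200 for the fifth polynomial makes this function nonincreasing.\<close>
    have "((\<lambda>x. q x / 4200 + S x) has_real_derivative (- r x) / 4200 + bern 5 (x - n) * f 5 x) (at x)"
      by (intro DERIV_add DERIV_cdivide q dS x)
    moreover have "(- r x) / 4200 + bern 5 (x - n) * f 5 x \<le> 0"
      using bd[OF x] by linarith
    ultimately show "\<exists>y. ((\<lambda>x. q x / 4200 + S x) has_real_derivative y) (at x) \<and> y \<le> 0" by blast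
  qed
  moreover have "q b / 4200 - S b \<le> q a / 4200 - S a"
  proof (rule DERIV_nonpos_imp_nonincreasing[OF n(2)])
    fix x assume x: "a \<le> x" "x \<le> b"
    have "((\<lambda>x. q x / 4200 - S x) has_real_derivative (- r x) / 4200 - bern 5 (x - n) * f 5 x) (at x)"
      by (intro DERIV_diff DERIV_cdivide q dS x)
    moreover have "(- r x) / 4200 - bern 5 (x - n) * f 5 x \<le> 0"
      using bd[OF x] by linarith
    ultimately show "\<exists>y. ((\<lambda>x. q x / 4200 - S x) has_real_derivative y) (at x) \<and> y \<le> 0" by blast
  qed
  ultimately show ?thesis unfolding S_def by (simp add: abs_le_iff diff_divide_distrib)
qed

text \<open>
  Of the five polynomials only the first one differs at the two ends of the unit interval, and it
  differs by 1.  This is how the summand enters at every integer.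
\<close>

lemma em_bdry_step: "em_bdry f 1 x = em_bdry f 0 x + f 0 x"
  by (simp add: em_bdry_def eval_nat_numeral)

text \<open>
  The starting point a may be any real number; k is its integer part.
\<close>

lemma euler_maclaurin:
  fixes f :: "nat \<Rightarrow> real \<Rightarrow> real" and a :: real and k N :: nat
  assumes der: "\<And>i x. i < 5 \<Longrightarrow> a \<le> x \<Longrightarrow> (f i has_real_derivative f (Suc i) x) (at x)"
    and \<Phi>: "\<And>x. a \<le> x \<Longrightarrow> (\<Phi> has_real_derivative f 0 x) (at x)"
    and q: "\<And>x. a \<le> x \<Longrightarrow> (q has_real_derivative - r x) (at x)"
    and r: "\<And>x. a \<le> x \<Longrightarrow> \<bar>f 5 x\<bar> \<le> r x"
    and k: "real k \<le> a" "a < real k + 1" and N: "k < N"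
  shows "\<bar>(\<Sum>n\<in>{k<..N}. f 0 n) + em_bdry f 0 N - \<Phi> N - (em_bdry f (a - k) a - \<Phi> a)\<bar>
           \<le> (q a - q N) / 4200"
  using N
proof (induction N)
  case 0
  then show ?case by simp
next
  case (Suc N)
  show ?case
  proof (cases "k < N")
    case True
    have "\<bar>(em_bdry f (real (Suc N) - N) (Suc N) - \<Phi> (Suc N)) - (em_bdry f (real N - N) N - \<Phi> N)\<bar>
            \<le> (q N - q (Suc N)) / 4200"
      by (rule em_segment[where r = r]) (use True k der \<Phi> q r in \<open>auto\<close>)
    moreover have "{k<..Suc N} = insert (Suc N) {k<..N}" using True by auto
    ultimately show ?thesis
      using Suc.IH[OF True] em_bdry_step[of f "real (Suc N)"]
      by (simp add: abs_le_iff diff_divide_distrib)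
  next
    case False
    then have [simp]: "N = k" using Suc by simp
    have "\<bar>(em_bdry f (real (Suc k) - k) (Suc k) - \<Phi> (Suc k)) - (em_bdry f (a - k) a - \<Phi> a)\<bar>
            \<le> (q a - q (Suc k)) / 4200"
      by (rule em_segment[where r = r]) (use k der \<Phi> q r in \<open>auto\<close>)
    moreover have "{k<..Suc k} = {Suc k}" by auto
    ultimately show ?thesis
      using em_bdry_step[of f "real (Suc k)"] by (simp add: add.commute add.left_commute)
  qed
qed

section \<open>Sums of logarithmic polynomials\<close>

text \<open>
  The coefficients are taken relative to w^i / i!, which turns differentiation into a shift of the
  index.
\<close>

definition logpoly :: "nat \<Rightarrow> (nat \<Rightarrow> real) \<Rightarrow> real \<Rightarrow> real" where
  "logpoly d \<phi> w = (\<Sum>i\<le>d. \<phi> i * w ^ i / fact i)"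

text \<open>
  The m-th derivative of P(ln x - t) / x is P_m(ln x - t) / x^(m+1), where P_m arises from P_{m-1} by
  applying D - m.  These are the coefficients of P_m.
\<close>

fun deriv_coeff :: "nat \<Rightarrow> (nat \<Rightarrow> real) \<Rightarrow> nat \<Rightarrow> real" where
  "deriv_coeff 0 \<phi> i = \<phi> i"
| "deriv_coeff (Suc m) \<phi> i = deriv_coeff m \<phi> (Suc i) - real (Suc m) * deriv_coeff m \<phi> i"

lemma deriv_coeff_0_eq [simp]: "deriv_coeff 0 \<phi> = \<phi>"
  by (simp add: fun_eq_iff)

lemma deriv_coeff_eq_0: "(\<And>i. i > d \<Longrightarrow> \<phi> i = 0) \<Longrightarrow> i > d \<Longrightarrow> deriv_coeff m \<phi> i = 0"
  by (induction m arbitrary: i) auto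

lemma logpoly_at_0 [simp]: "logpoly d \<phi> 0 = \<phi> 0"
  unfolding logpoly_def by (subst sum.atMost_shift) simp

lemma logpoly_diff_cmult: "logpoly d (\<lambda>i. \<phi> i - c * \<psi> i) w = logpoly d \<phi> w - c * logpoly d \<psi> w"
  by (simp add: logpoly_def sum_subtractf sum_distrib_left left_diff_distrib diff_divide_distrib mult.assoc)

lemma logpoly_deriv:
  assumes "\<phi> (Suc d) = 0"
  shows "(logpoly d \<phi> has_real_derivative logpoly d (\<lambda>i. \<phi> (Suc i)) w) (at w)"
proof -
  have "(logpoly d \<phi> has_real_derivative (\<Sum>i\<le>d. \<phi> i * (real i * w ^ (i - 1)) / fact i)) (at w)"
    unfolding logpoly_def by (auto intro!: derivative_eq_intros sum.cong)
  also have "(\<Sum>i\<le>d. \<phi> i * (real i * w ^ (i - 1)) / fact i) = logpoly d (\<lambda>i. \<phi> (Suc i)) w"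
  proof (cases d)
    case (Suc d')
    have eq: "\<phi> (Suc i) * (real (Suc i) * w ^ i) / fact (Suc i) = \<phi> (Suc i) * w ^ i / fact i" for i
      by (simp add: fact_Suc del: of_nat_Suc)
    have "(\<Sum>i\<le>Suc d'. \<phi> i * (real i * w ^ (i - 1)) / fact i)
        = (\<Sum>i\<le>d'. \<phi> (Suc i) * (real (Suc i) * w ^ i) / fact (Suc i))"
      by (subst sum.atMost_Suc_shift) simp
    also have "\<dots> = (\<Sum>i\<le>Suc d'. \<phi> (Suc i) * w ^ i / fact i)"
      unfolding eq using assms by (simp add: Suc)
    finally show ?thesis by (simp add: Suc logpoly_def)
  qed (use assms in \<open>simp add: logpoly_def\<close>)
  finally show ?thesis .
qed

lemma logpoly_over_power_deriv:
  assumes "\<phi> (Suc d) = 0" "x > 0"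
  shows "((\<lambda>x. logpoly d \<phi> (ln x - t) / x ^ m) has_real_derivative
           logpoly d (\<lambda>i. \<phi> (Suc i) - real m * \<phi> i) (ln x - t) / x ^ Suc m) (at x)"
proof -
  let ?l = "logpoly d \<phi> (ln x - t)" and ?l' = "logpoly d (\<lambda>i. \<phi> (Suc i)) (ln x - t)"
  have *: "((\<lambda>x. logpoly d \<phi> (ln x - t)) has_real_derivative ?l' * (1 / x)) (at x)"
    by (rule DERIV_chain2[OF logpoly_deriv]) (use assms in \<open>auto intro!: derivative_eq_intros\<close>)
  show ?thesis
  proof (cases m)
    case 0
    then show ?thesis using * by simp
  next
    case (Suc n)
    have "((\<lambda>x. x ^ Suc n) has_real_derivative real (Suc n) * x ^ n) (at x)"
      using DERIV_pow[of "Suc n" x] by simp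
    from DERIV_divide[OF * this] assms(2)
    have "((\<lambda>x. logpoly d \<phi> (ln x - t) / x ^ Suc n) has_real_derivative
        (?l' * (1 / x) * x ^ Suc n - ?l * (real (Suc n) * x ^ n)) / (x ^ Suc n * x ^ Suc n)) (at x)"
      by simp
    also have "(?l' * (1 / x) * x ^ Suc n - ?l * (real (Suc n) * x ^ n)) / (x ^ Suc n * x ^ Suc n)
        = (?l' - real (Suc n) * ?l) / x ^ Suc (Suc n)"
      using assms(2) by (simp add: divide_simps del: of_nat_Suc) (simp add: algebra_simps del: of_nat_Suc)
    finally show ?thesis unfolding logpoly_diff_cmult Suc .
  qed
qed

definition logpoly_deriv_seq :: "nat \<Rightarrow> (nat \<Rightarrow> real) \<Rightarrow> real \<Rightarrow> nat \<Rightarrow> real \<Rightarrow> real" where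
  "logpoly_deriv_seq d \<phi> t m x = logpoly d (deriv_coeff m \<phi>) (ln x - t) / x ^ Suc m"

definition logpoly_primitive :: "nat \<Rightarrow> (nat \<Rightarrow> real) \<Rightarrow> real \<Rightarrow> real" where
  "logpoly_primitive d \<phi> = logpoly (Suc d) (case_nat 0 \<phi>)"

text \<open>
  The solution of (5 - D) Q = G for the polynomial G with coefficients \<bar>\<psi> i\<bar>.  Then
  Q(ln x - t) / x^5 has the derivative - G(ln x - t) / x^6, so Q serves as the dominating
  function for a fifth derivative with coefficients \<psi>.
\<close>

definition majorant_coeff :: "nat \<Rightarrow> (nat \<Rightarrow> real) \<Rightarrow> nat \<Rightarrow> real" where
  "majorant_coeff d \<psi> i = (\<Sum>j\<in>{i..d}. \<bar>\<psi> j\<bar> / 5 ^ Suc (j - i))"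

lemma majorant_coeff_rec:
  assumes "i \<le> d"
  shows "majorant_coeff d \<psi> (Suc i) - 5 * majorant_coeff d \<psi> i = - \<bar>\<psi> i\<bar>"
proof -
  have "{i..d} = insert i {Suc i..d}" using assms by auto
  then have "5 * majorant_coeff d \<psi> i = \<bar>\<psi> i\<bar> + (\<Sum>j\<in>{Suc i..d}. 5 * (\<bar>\<psi> j\<bar> / 5 ^ Suc (j - i)))"
    by (simp add: majorant_coeff_def sum_distrib_left distrib_left)
  also have "(\<Sum>j\<in>{Suc i..d}. 5 * (\<bar>\<psi> j\<bar> / 5 ^ Suc (j - i))) = majorant_coeff d \<psi> (Suc i)"
    unfolding majorant_coeff_def
  proof (intro sum.cong refl)
    fix j assume "j \<in> {Suc i..d}"
    then have "Suc (j - Suc i) = j - i" by auto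
    then show "5 * (\<bar>\<psi> j\<bar> / 5 ^ Suc (j - i)) = \<bar>\<psi> j\<bar> / 5 ^ Suc (j - Suc i)"
      by (simp del: power_Suc) simp
  qed
  finally show ?thesis by simp
qed

lemma majorant_coeff_nonneg: "majorant_coeff d \<psi> i \<ge> 0"
  by (auto simp: majorant_coeff_def intro!: sum_nonneg)

lemma logpoly_abs_le:
  assumes "w \<ge> 0"
  shows "\<bar>logpoly d \<phi> w\<bar> \<le> logpoly d (\<lambda>i. \<bar>\<phi> i\<bar>) w"
  unfolding logpoly_def
  by (rule order.trans[OF sum_abs]) (use assms in \<open>auto simp: abs_mult intro!: sum_mono\<close>)

lemma logpoly_nonneg: "w \<ge> 0 \<Longrightarrow> (\<And>i. \<phi> i \<ge> 0) \<Longrightarrow> logpoly d \<phi> w \<ge> 0"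
  by (auto simp: logpoly_def intro!: sum_nonneg)

lemma logpoly_ln_over_power_tendsto_0:
  "((\<lambda>x. logpoly d \<phi> (ln x - t) / x ^ Suc m) \<longlongrightarrow> 0) at_top"
proof -
  have lim: "filterlim (\<lambda>x::real. ln x - t) at_top at_top"
    using filterlim_tendsto_add_at_top[OF tendsto_const[of "-t"] ln_at_top] by simp
  have "((\<lambda>x::real. \<phi> i * (ln x - t) ^ i / fact i / x ^ Suc m) \<longlongrightarrow> 0) at_top" for i
  proof -
    have "((\<lambda>x. (ln x - t) ^ i / exp (ln x - t)) \<longlongrightarrow> 0) at_top"
      by (rule filterlim_compose[OF tendsto_power_div_exp_0 lim])
    moreover have "((\<lambda>x::real. inverse (x ^ m)) \<longlongrightarrow> (if m = 0 then 1 else 0)) at_top"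
      using tendsto_inverse_0_at_top[OF filterlim_pow_at_top[OF _ filterlim_ident], of m]
      by (cases "m = 0") auto
    ultimately have "((\<lambda>x. \<phi> i / fact i * exp (-t) * ((ln x - t) ^ i / exp (ln x - t) * inverse (x ^ m)))
        \<longlongrightarrow> \<phi> i / fact i * exp (-t) * (0 * (if m = 0 then 1 else 0))) at_top"
      by (intro tendsto_intros)
    moreover have "\<forall>\<^sub>F x in at_top. \<phi> i / fact i * exp (-t) * ((ln x - t) ^ i / exp (ln x - t) * inverse (x ^ m))
              = \<phi> i * (ln x - t) ^ i / fact i / x ^ Suc m"
      using eventually_gt_at_top[of 0]
      by eventually_elim (simp add: exp_diff exp_minus field_simps)
    ultimately show ?thesis
      by (simp add: tendsto_cong)
  qed
  from tendsto_sum[of "{..d}", OF this] show ?thesis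
    by (simp add: logpoly_def sum_divide_distrib)
qed

context
  fixes d :: nat and \<phi> :: "nat \<Rightarrow> real" and t a :: real
  assumes supp: "\<And>i. i > d \<Longrightarrow> \<phi> i = 0" and a: "a \<ge> 1" "t \<le> ln a"
begin

abbreviation (input) "lp_seq \<equiv> logpoly_deriv_seq d \<phi> t"
abbreviation (input) "lp_prim \<equiv> \<lambda>x. logpoly_primitive d \<phi> (ln x - t)"
abbreviation (input) "lp_maj \<equiv> \<lambda>x. logpoly d (majorant_coeff d (deriv_coeff 5 \<phi>)) (ln x - t) / x ^ 5"

lemma logpoly_euler_maclaurin:
  fixes k N :: nat
  assumes k: "real k \<le> a" "a < real k + 1" and N: "k < N"
  shows "\<bar>(\<Sum>n\<in>{k<..N}. lp_seq 0 (real n)) + em_bdry lp_seq 0 N - lp_prim N - (em_bdry lp_seq (a - k) a - lp_prim a)\<bar>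
           \<le> (lp_maj a - lp_maj N) / 4200"
proof (rule euler_maclaurin[where r = "\<lambda>x. logpoly d (\<lambda>i. \<bar>deriv_coeff 5 \<phi> i\<bar>) (ln x - t) / x ^ 6", OF _ _ _ _ k N])
  fix x assume x: "a \<le> x"
  then have x0: "x > 0" using a by simp
  then have "ln a \<le> ln x" using a x by simp
  then have w: "ln x - t \<ge> 0" using a by simp
  have deriv_coeff_Suc: "deriv_coeff (Suc i) \<phi> = (\<lambda>j. deriv_coeff i \<phi> (Suc j) - real (Suc i) * deriv_coeff i \<phi> j)" for i
    by (simp add: fun_eq_iff)
  show "(lp_seq i has_real_derivative lp_seq (Suc i) x) (at x)" for i
    unfolding logpoly_deriv_seq_def[abs_def] deriv_coeff_Suc
        using logpoly_over_power_deriv[OF _ x0, where \<phi> = "deriv_coeff i \<phi>" and d = d and t = t and m = "Suc i"]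
      deriv_coeff_eq_0[where d = d and i = "Suc d" and m = i and \<phi> = \<phi>, OF supp]
    by simp
  show "(lp_prim has_real_derivative lp_seq 0 x) (at x)"
  proof -
    have "logpoly (Suc d) (case_nat 0 \<phi> \<circ> Suc) (ln x - t) = logpoly d \<phi> (ln x - t)"
      using supp[of "Suc d"] by (simp add: logpoly_def)
    then show ?thesis
      using logpoly_over_power_deriv[OF _ x0, where \<phi> = "case_nat 0 \<phi>" and d = "Suc d" and t = t and m = 0]
          supp[of "Suc d"]
      by (simp add: logpoly_deriv_seq_def logpoly_primitive_def o_def fun_eq_iff)
  qed
  show "(lp_maj has_real_derivative - (logpoly d (\<lambda>i. \<bar>deriv_coeff 5 \<phi> i\<bar>) (ln x - t) / x ^ 6)) (at x)"
  proof -
    have "logpoly d (\<lambda>i. majorant_coeff d (deriv_coeff 5 \<phi>) (Suc i) - 5 * majorant_coeff d (deriv_coeff 5 \<phi>) i) (ln x - t)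
        = - logpoly d (\<lambda>i. \<bar>deriv_coeff 5 \<phi> i\<bar>) (ln x - t)"
      unfolding logpoly_def sum_negf[symmetric]
      by (intro sum.cong refl) (subst majorant_coeff_rec, auto)
    then show ?thesis
      using logpoly_over_power_deriv[OF _ x0, where \<phi> = "majorant_coeff d (deriv_coeff 5 \<phi>)" and d = d and t
          = t and m = 5]
      by (simp add: majorant_coeff_def[of _ _ "Suc d"])
  qed
  show "\<bar>lp_seq 5 x\<bar> \<le> logpoly d (\<lambda>i. \<bar>deriv_coeff 5 \<phi> i\<bar>) (ln x - t) / x ^ 6"
    using logpoly_abs_le[OF w] x0 by (simp add: logpoly_deriv_seq_def divide_right_mono abs_mult)
qed

lemma em_bdry_logpoly_tendsto_0: "(\<lambda>N. em_bdry lp_seq 0 (real N)) \<longlonglongrightarrow> 0"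
proof -
  have "(\<lambda>N. lp_seq j (real N)) \<longlonglongrightarrow> 0" for j
    unfolding logpoly_deriv_seq_def
    by (rule filterlim_compose[OF logpoly_ln_over_power_tendsto_0 filterlim_real_sequentially])
  then show ?thesis
    unfolding em_bdry_def by (intro tendsto_null_sum) (auto intro!: tendsto_mult_right_zero)
qed

lemma logpoly_majorant_tendsto_0: "(\<lambda>N. lp_maj (real N)) \<longlonglongrightarrow> 0"
  using filterlim_compose[OF logpoly_ln_over_power_tendsto_0 filterlim_real_sequentially,
          of d "majorant_coeff d (deriv_coeff 5 \<phi>)" t 4] by (simp add: eval_nat_numeral)

lemma logpoly_sum_limit:
  fixes k :: nat
  assumes k: "real k \<le> a" "a < real k + 1"
    and lim: "(\<lambda>N. (\<Sum>n\<in>{k<..N}. lp_seq 0 (real n)) - lp_prim (real N)) \<longlonglongrightarrow> \<Lambda>"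
  shows "\<bar>\<Lambda> - (em_bdry lp_seq (a - k) a - lp_prim a)\<bar> \<le> lp_maj a / 4200"
proof (rule tendsto_upperbound)
  show "(\<lambda>N. \<bar>((\<Sum>n\<in>{k<..N}. lp_seq 0 (real n)) - lp_prim (real N)) + em_bdry lp_seq 0 (real N)
           - (em_bdry lp_seq (a - k) a - lp_prim a)\<bar> + lp_maj (real N) / 4200)
      \<longlonglongrightarrow> \<bar>\<Lambda> - (em_bdry lp_seq (a - k) a - lp_prim a)\<bar>"
    by (rule tendsto_eq_intros lim em_bdry_logpoly_tendsto_0 logpoly_majorant_tendsto_0 refl | simp)+
  show "\<forall>\<^sub>F N in sequentially. \<bar>((\<Sum>n\<in>{k<..N}. lp_seq 0 (real n)) - lp_prim (real N)) + em_bdry lp_seq 0 (real N)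
           - (em_bdry lp_seq (a - k) a - lp_prim a)\<bar> + lp_maj (real N) / 4200 \<le> lp_maj a / 4200"
    using eventually_gt_at_top[of k]
  proof eventually_elim
    case (elim N)
    then show ?case
      using logpoly_euler_maclaurin[OF k elim] by (simp add: diff_divide_distrib algebra_simps)
  qed
qed simp

end

text \<open>
  By the Euler--Maclaurin estimate the sequence plus a null sequence is decreasing and bounded below.
\<close>

lemma logpoly_sum_convergent:
  assumes supp: "\<And>i. i > d \<Longrightarrow> \<phi> i = 0"
  shows "convergent (\<lambda>N. (\<Sum>n\<in>{0<..N}. logpoly d \<phi> (ln (real n)) / real n)
            - logpoly_primitive d \<phi> (ln (real N)))"
proof -
  define f where "f = logpoly_deriv_seq d \<phi> 0"
  define q where "q x = logpoly d (majorant_coeff d (deriv_coeff 5 \<phi>)) (ln x - 0) / x ^ 5" for x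
  define s where "s = (\<lambda>N::nat. (\<Sum>n\<in>{0<..N}. f 0 (real n)) - logpoly_primitive d \<phi> (ln (real N) - 0))"
  define W where "W = (\<lambda>N::nat. s N + em_bdry f 0 (real N))"
  have W: "\<bar>W M - W N\<bar> \<le> (q N - q M) / 4200" if "1 \<le> N" "N \<le> M" for M N :: nat
  proof (cases "N = M")
    case False
    have "(\<Sum>n\<in>{0<..M}. f 0 (real n)) = (\<Sum>n\<in>{0<..N}. f 0 (real n)) + (\<Sum>n\<in>{N<..M}. f 0 (real n))"
      using that by (subst sum.union_disjoint[symmetric]) (auto intro!: sum.cong)
    with logpoly_euler_maclaurin[where d = d and \<phi> = \<phi> and a = "real N" and t = 0 and k = N and N = M, OF supp]
        that False show ?thesis
      unfolding W_def s_def f_def q_def by (simp add: algebra_simps)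
  qed auto
  have q: "q (real N) \<ge> 0" if "1 \<le> N" for N :: nat
    using that by (auto simp: q_def intro!: divide_nonneg_nonneg logpoly_nonneg majorant_coeff_nonneg)
  have q0: "(\<lambda>N. q (real N)) \<longlonglongrightarrow> 0"
    unfolding q_def by (rule logpoly_majorant_tendsto_0[where a = 1]) (use supp in auto)
  have "convergent (\<lambda>N. W (Suc N) + q (real (Suc N)) / 4200)"
  proof -
    have "decseq (\<lambda>N. W (Suc N) + q (real (Suc N)) / 4200)"
    proof (rule decseq_SucI)
      fix N show "W (Suc (Suc N)) + q (real (Suc (Suc N))) / 4200 \<le> W (Suc N) + q (real (Suc N)) / 4200"
        using W[of "Suc N" "Suc (Suc N)"] by (simp add: diff_divide_distrib abs_le_iff)
    qed
    moreover have "\<forall>N. W 1 - q (real 1) / 4200 \<le> W (Suc N) + q (real (Suc N)) / 4200"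
    proof
      fix N show "W 1 - q (real 1) / 4200 \<le> W (Suc N) + q (real (Suc N)) / 4200"
        using W[of 1 "Suc N"] q[of "Suc N"] by (simp add: diff_divide_distrib abs_le_iff)
    qed
    ultimately show ?thesis
      using decseq_convergent by (meson convergentI)
  qed
  then obtain l where "(\<lambda>N. W (Suc N) + q (real (Suc N)) / 4200) \<longlonglongrightarrow> l"
    by (auto simp: convergent_def)
  then have "(\<lambda>N. W N + q (real N) / 4200) \<longlonglongrightarrow> l"
    by (rule filterlim_sequentially_Suc[THEN iffD1])
  moreover have "(\<lambda>N. em_bdry f 0 (real N)) \<longlonglongrightarrow> 0"
    unfolding f_def by (rule em_bdry_logpoly_tendsto_0[where a = 1]) (use supp in auto)
  ultimately have "(\<lambda>N. W N + q (real N) / 4200 - q (real N) / 4200 - em_bdry f 0 (real N)) \<longlonglongrightarrow> l - 0 / 4200 - 0"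
    by (intro tendsto_intros q0) auto
  then have "convergent s"
    by (auto simp: W_def convergent_def)
  then show ?thesis
    by (simp add: s_def f_def logpoly_deriv_seq_def logpoly_def)
qed

section \<open>Stieltjes constants as limits and the smoothed counting defect\<close>

lemma logpoly_monomial: "logpoly k (\<lambda>i. if i = k then fact k else 0) w = w ^ k"
  by (simp add: logpoly_def if_distrib if_distribR cong: if_cong)

lemma logpoly_primitive_monomial:
  "logpoly_primitive k (\<lambda>i. if i = k then fact k else 0) w = w ^ Suc k / real (Suc k)"
proof -
  have "logpoly_primitive k (\<lambda>i. if i = k then fact k else 0) w
      = (\<Sum>i\<le>Suc k. if i = Suc k then fact k * w ^ Suc k / fact (Suc k) else 0)"
    unfolding logpoly_primitive_def logpoly_def by (intro sum.cong) (auto split: nat.split)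
  also have "\<dots> = w ^ Suc k / real (Suc k)"
    by (subst sum.delta) (auto simp: fact_Suc simp del: of_nat_Suc)
  finally show ?thesis .
qed

text \<open>
  The classical limit formula for the Stieltjes constants.  That it gives the Laurent coefficients of
  zeta at 1 is proved only near the end, where it is needed for k \<le> 3.
\<close>

definition stieltjes_lim :: "nat \<Rightarrow> real" where
  "stieltjes_lim k = lim (\<lambda>N. (\<Sum>n\<in>{0<..N}. ln (real n) ^ k / real n) - ln (real N) ^ Suc k / real (Suc k))"

lemma stieltjes_lim_limit:
  "(\<lambda>N. (\<Sum>n\<in>{0<..N}. ln (real n) ^ k / real n) - ln (real N) ^ Suc k / real (Suc k)) \<longlonglongrightarrow> stieltjes_lim k"
  using logpoly_sum_convergent[of k "\<lambda>i. if i = k then fact k else 0"]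
  unfolding logpoly_monomial logpoly_primitive_monomial stieltjes_lim_def convergent_LIMSEQ_iff by simp

text \<open>
  The Taylor coefficients of \<zeta>'(1 + h) + 1/h^2 at h = 0, expressed by the limits.
\<close>

definition taylor_coeff :: "nat \<Rightarrow> real" where
  "taylor_coeff j = (-1) ^ Suc j * stieltjes_lim (Suc j) / fact j"

text \<open>
  The (p+1)-fold primitive of the signed measure t dt - \<Sum> (ln n / n) \<delta>_{ln n}.
\<close>

definition defect :: "nat \<Rightarrow> real \<Rightarrow> real" where
  "defect p t = t ^ (p + 2) / fact (p + 2)
     - (\<Sum>n\<in>{0<..nat \<lfloor>exp t\<rfloor>}. ln (real n) / real n * ((t - ln (real n)) ^ p / fact p))"

text \<open>
  What is left of the defect after its polynomial growth at infinity has been removed.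
\<close>

definition remainder :: "nat \<Rightarrow> real \<Rightarrow> real" where
  "remainder p t = defect p t - (\<Sum>j\<le>p. taylor_coeff j * t ^ (p - j) / fact (p - j))"

text \<open>
  Coefficients of (t + w) w^p / p!.  With w = ln x - t this polynomial divided by x is the summand
  ln x (ln x - t)^p / (p! x), which vanishes to order p at x = e^t.
\<close>

definition kernel_coeff :: "nat \<Rightarrow> real \<Rightarrow> nat \<Rightarrow> real" where
  "kernel_coeff p t i = (if i = p then t else if i = Suc p then real (Suc p) else 0)"

lemma logpoly_kernel_coeff: "logpoly (Suc p) (kernel_coeff p t) w = (t + w) * w ^ p / fact p"
proof -
  have "logpoly (Suc p) (kernel_coeff p t) w = (\<Sum>i\<in>{p, Suc p}. kernel_coeff p t i * w ^ i / fact i)"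
    unfolding logpoly_def by (rule sum.mono_neutral_right) (auto simp: kernel_coeff_def)
  also have "\<dots> = (t + w) * w ^ p / fact p"
    by (simp add: kernel_coeff_def fact_Suc distrib_right add_divide_distrib del: of_nat_Suc)
  finally show ?thesis .
qed

lemma logpoly_primitive_kernel_coeff:
  "logpoly_primitive (Suc p) (kernel_coeff p t) w =
     t * w ^ Suc p / fact (Suc p) + real (Suc p) * w ^ (p + 2) / fact (p + 2)"
proof -
  have "logpoly_primitive (Suc p) (kernel_coeff p t) w
      = (\<Sum>i\<in>{Suc p, p + 2}. case_nat 0 (kernel_coeff p t) i * w ^ i / fact i)"
    unfolding logpoly_def logpoly_primitive_def
    by (rule sum.mono_neutral_right) (auto simp: kernel_coeff_def split: nat.split)
  also have "\<dots> = t * w ^ Suc p / fact (Suc p) + real (Suc p) * w ^ (p + 2) / fact (p + 2)"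
    by (simp add: kernel_coeff_def del: of_nat_Suc fact_Suc)
  finally show ?thesis .
qed

lemma power_diff_over_fact:
  fixes u t :: real
  shows "(u - t) ^ p / fact p = (\<Sum>j\<le>p. u ^ j / fact j * ((- t) ^ (p - j) / fact (p - j)))"
proof -
  have "(u + - t) ^ p / fact p = (\<Sum>j\<le>p. real (p choose j) * u ^ j * (- t) ^ (p - j) / fact p)"
    unfolding binomial_ring by (simp add: sum_divide_distrib)
  also have "\<dots> = (\<Sum>j\<le>p. u ^ j / fact j * ((- t) ^ (p - j) / fact (p - j)))"
    by (intro sum.cong refl) (simp add: binomial_fact)
  finally show ?thesis by simp
qed

text \<open>
  Both sides have the derivative u (u - t)^p / p! with respect to u and agree at u = 0.
\<close>

lemma logpoly_primitive_kernel_coeff_expand: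
  "logpoly_primitive (Suc p) (kernel_coeff p t) (u - t) =
     (\<Sum>j\<le>p. u ^ (j + 2) / (real (j + 2) * fact j) * ((- t) ^ (p - j) / fact (p - j)))
     - (-1) ^ p * t ^ (p + 2) / fact (p + 2)"
proof -
  define h where "h = (\<lambda>u. logpoly_primitive (Suc p) (kernel_coeff p t) (u - t)
     - (\<Sum>j\<le>p. u ^ (j + 2) / (real (j + 2) * fact j) * ((- t) ^ (p - j) / fact (p - j))))"
  have pow: "((\<lambda>u. (u - t) ^ Suc n / fact (Suc n)) has_real_derivative (u - t) ^ n / fact n) (at u)" for n u
    by (rule DERIV_cong, rule DERIV_cdivide[OF DERIV_power[of "\<lambda>u. u - t" 1]])
       (auto intro!: derivative_eq_intros simp: fact_Suc simp del: of_nat_Suc)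
  have "(h has_real_derivative 0) (at u)" for u
  proof -
    have "(h has_real_derivative
        t * ((u - t) ^ p / fact p) + real (Suc p) * ((u - t) ^ Suc p / fact (Suc p))
        - (\<Sum>j\<le>p. u ^ (j + 1) / fact j * ((- t) ^ (p - j) / fact (p - j)))) (at u)"
      unfolding h_def logpoly_primitive_kernel_coeff
    proof (intro DERIV_diff DERIV_sum DERIV_add DERIV_cmult_right)
      show "((\<lambda>u. t * (u - t) ^ Suc p / fact (Suc p)) has_real_derivative t * ((u - t) ^ p / fact p)) (at u)"
        using DERIV_cmult[OF pow[of p u], of t] by simp
      show "((\<lambda>u. real (Suc p) * (u - t) ^ (p + 2) / fact (p + 2)) has_real_derivative
          real (Suc p) * ((u - t) ^ Suc p / fact (Suc p))) (at u)"
        using DERIV_cmult[OF pow[of "Suc p" u], of "real (Suc p)"] by (simp del: fact_Suc of_nat_Suc)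
      show "((\<lambda>u. u ^ (j + 2) / (real (j + 2) * fact j)) has_real_derivative u ^ (j + 1) / fact j) (at u)" for j
        by (rule DERIV_cong, rule DERIV_cdivide[OF DERIV_pow]) simp
    qed
    also have "t * ((u - t) ^ p / fact p) + real (Suc p) * ((u - t) ^ Suc p / fact (Suc p))
        = u * ((u - t) ^ p / fact p)"
    proof -
      have "real (Suc p) * ((u - t) ^ Suc p / fact (Suc p)) = (u - t) * ((u - t) ^ p / fact p)"
        by (simp add: fact_Suc del: of_nat_Suc)
      then show ?thesis by (simp only: flip: distrib_right) simp
    qed
    also have "\<dots> = (\<Sum>j\<le>p. u ^ (j + 1) / fact j * ((- t) ^ (p - j) / fact (p - j)))"
      unfolding power_diff_over_fact sum_distrib_left by (simp add: mult.assoc)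
    finally show ?thesis by simp
  qed
  then have "h u = h 0"
    using DERIV_isconst_all by blast
  also have "h 0 = - ((-1) ^ p * t ^ (p + 2) / fact (p + 2))"
  proof -
    have "real (Suc p) * (-t) ^ (p + 2) / fact (p + 2) + t * (-t) ^ Suc p / fact (Suc p)
        = - ((-1) ^ p * t ^ (p + 2) / fact (p + 2))"
    proof -
      define P where "P = (-1) ^ p * t ^ (p + 2)"
      have 1: "(-t) ^ (p + 2) = P" "t * (-t) ^ Suc p = - P"
        by (simp_all add: P_def power_minus[of t] mult_ac)
      have 2: "fact (p + 2) = real (p + 2) * fact (Suc p)"
        by (simp add: fact_Suc)
      show ?thesis
        unfolding 1 2 P_def[symmetric] by (simp add: divide_simps del: fact_Suc) (simp add: algebra_simps)
    qed
    then show ?thesis by (simp add: h_def logpoly_primitive_kernel_coeff add.commute)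
  qed
  finally show ?thesis by (simp add: h_def)
qed

text \<open>
  By the binomial theorem the full sums over n \<le> N converge to a polynomial in t whose coefficients are
  the limits \<open>stieltjes_lim\<close>; the summands with n \<le> e^t that are missing here make up the defect.
\<close>

lemma remainder_limit:
  assumes "t \<ge> 0" and k: "k = nat \<lfloor>exp t\<rfloor>"
  shows "(\<lambda>N. (\<Sum>n\<in>{k<..N}. logpoly_deriv_seq (Suc p) (kernel_coeff p t) t 0 (real n))
            - logpoly_primitive (Suc p) (kernel_coeff p t) (ln (real N) - t))
         \<longlonglongrightarrow> (-1) ^ p * remainder p t"
proof -
  define F where "F n = ln (real n) * (ln (real n) - t) ^ p / fact p / real n" for n :: nat
  define b where "b j = (- t) ^ (p - j) / fact (p - j) / fact j" for j
  define S where "S k N = (\<Sum>n\<in>{0<..N}. ln (real n) ^ Suc k / real n) - ln (real N) ^ (k + 2) / real (k + 2)"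
    for k N
  have S: "S j \<longlonglongrightarrow> stieltjes_lim (Suc j)" for j
    using stieltjes_lim_limit[of "Suc j"] unfolding S_def by simp
  have F: "F n = (\<Sum>j\<le>p. b j * (ln (real n) ^ Suc j / real n))" for n
    unfolding F_def times_divide_eq_right[symmetric] power_diff_over_fact b_def
    by (simp add: sum_distrib_left sum_divide_distrib mult_ac)
  have sumF: "(\<Sum>n\<in>{0<..k}. F n) = (-1) ^ p *
      (\<Sum>n\<in>{0<..k}. ln (real n) / real n * ((t - ln (real n)) ^ p / fact p))"
  proof -
    have "(ln (real n) - t) ^ p = (-1) ^ p * (t - ln (real n)) ^ p" for n
      by (simp flip: power_mult_distrib)
    then show ?thesis by (simp add: F_def sum_distrib_left mult_ac)
  qed
  have "(\<lambda>N. (\<Sum>j\<le>p. b j * S j N) - (\<Sum>n\<in>{0<..k}. F n) + (-1) ^ p * t ^ (p + 2) / fact (p + 2))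
      \<longlonglongrightarrow> (\<Sum>j\<le>p. b j * stieltjes_lim (Suc j)) - (\<Sum>n\<in>{0<..k}. F n) + (-1) ^ p * t ^ (p + 2) / fact (p + 2)"
    by (intro tendsto_intros S)
  also have "(\<Sum>j\<le>p. b j * stieltjes_lim (Suc j)) - (\<Sum>n\<in>{0<..k}. F n) + (-1) ^ p * t ^ (p + 2) / fact (p + 2)
      = (-1) ^ p * remainder p t"
  proof -
    have "b j * stieltjes_lim (Suc j) = - ((-1) ^ p * (taylor_coeff j * t ^ (p - j) / fact (p - j)))" if "j \<le> p" for j
    proof -
      have "(-t) ^ (p - j) = (-1) ^ p * (-1) ^ j * t ^ (p - j)"
        using that by (subst power_minus) (simp add: minus_one_power_iff)
      then show ?thesis by (simp add: b_def taylor_coeff_def mult_ac)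
    qed
    then have "(\<Sum>j\<le>p. b j * stieltjes_lim (Suc j)) = - ((-1) ^ p * (\<Sum>j\<le>p. taylor_coeff j * t ^ (p - j) / fact (p - j)))"
      by (simp add: sum_distrib_left sum_negf)
    then show ?thesis
      unfolding sumF by (simp add: remainder_def defect_def k algebra_simps)
  qed
  finally show ?thesis
  proof (rule Lim_transform_eventually)
    show "\<forall>\<^sub>F N in sequentially.
        (\<Sum>j\<le>p. b j * S j N) - (\<Sum>n\<in>{0<..k}. F n) + (-1) ^ p * t ^ (p + 2) / fact (p + 2)
        = (\<Sum>n\<in>{k<..N}. logpoly_deriv_seq (Suc p) (kernel_coeff p t) t 0 (real n))
            - logpoly_primitive (Suc p) (kernel_coeff p t) (ln (real N) - t)"
      using eventually_ge_at_top[of k]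
    proof eventually_elim
      case (elim N)
      have "(\<Sum>n\<in>{0<..N}. F n) = (\<Sum>n\<in>{0<..k}. F n) + (\<Sum>n\<in>{k<..N}. F n)"
        using elim by (subst sum.union_disjoint[symmetric]) (auto intro!: sum.cong)
      moreover have "(\<Sum>n\<in>{0<..N}. F n) = (\<Sum>j\<le>p. b j * (\<Sum>n\<in>{0<..N}. ln (real n) ^ Suc j / real n))"
        unfolding F sum_distrib_left by (rule sum.swap)
      moreover have "logpoly_deriv_seq (Suc p) (kernel_coeff p t) t 0 (real n) = F n" for n
        by (simp add: logpoly_deriv_seq_def F_def) (simp add: logpoly_kernel_coeff[unfolded fun_eq_iff])
      moreover have "logpoly_primitive (Suc p) (kernel_coeff p t) (ln (real N) - t)
          = (\<Sum>j\<le>p. b j * (ln (real N) ^ (j + 2) / real (j + 2))) - (-1) ^ p * t ^ (p + 2) / fact (p + 2)"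
        unfolding logpoly_primitive_kernel_coeff_expand b_def by (simp add: mult_ac)
      ultimately show ?case
        by (simp add: S_def right_diff_distrib sum_subtractf)
    qed
  qed
qed

lemma remainder_euler_maclaurin:
  assumes "t \<ge> 0"
  shows "\<bar>(-1) ^ p * remainder p t
      - (\<Sum>j<5. (-1) ^ j * bern (Suc j) (frac (exp t)) * (deriv_coeff j (kernel_coeff p t) 0 / exp t ^ Suc j))\<bar>
     \<le> majorant_coeff (Suc p) (deriv_coeff 5 (kernel_coeff p t)) 0 / exp t ^ 5 / 4200"
proof -
  define k where "k = nat \<lfloor>exp t\<rfloor>"
  have fl: "real k = of_int \<lfloor>exp t\<rfloor>" by (simp add: k_def)
  have e: "exp t \<ge> 1" using assms by simp
  have "\<bar>(-1) ^ p * remainder p t - (em_bdry (logpoly_deriv_seq (Suc p) (kernel_coeff p t) t) (exp t - k) (exp t)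
       - logpoly_primitive (Suc p) (kernel_coeff p t) (ln (exp t) - t))\<bar>
     \<le> (logpoly (Suc p) (majorant_coeff (Suc p) (deriv_coeff 5 (kernel_coeff p t))) (ln (exp t) - t) / exp t ^ 5) / 4200"
  proof (rule logpoly_sum_limit[OF _ e])
    show "real k \<le> exp t" "exp t < real k + 1" unfolding fl by linarith+
  qed (use remainder_limit[OF assms k_def, of p] in \<open>auto simp: kernel_coeff_def\<close>)
  then show ?thesis
    by (simp add: em_bdry_def fl frac_def logpoly_deriv_seq_def logpoly_primitive_kernel_coeff del: deriv_coeff.simps)
qed

section \<open>Numerical enclosures\<close>

lemma ln_2_bounds: "69314718/10^8 \<le> ln (2::real)" "ln (2::real) \<le> 69314719/10^8"
  using ln_approx_bounds[of 2 9] by (simp_all add: eval_nat_numeral)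

lemma ln_3_bounds: "109861228/10^8 \<le> ln (3::real)" "ln (3::real) \<le> 109861230/10^8"
proof -
  have "ln (3::real) = ln 2 + ln (3/2)" by (simp flip: ln_mult_pos)
  then show "109861228/10^8 \<le> ln (3::real)" "ln (3::real) \<le> 109861230/10^8"
    using ln_2_bounds ln_approx_bounds[of "3/2" 6] by (simp_all add: eval_nat_numeral)
qed

lemma ln_5_bounds: "160943790/10^8 \<le> ln (5::real)" "ln (5::real) \<le> 160943795/10^8"
proof -
  have "ln (5::real) = ln 2 + ln 2 + ln (5/4)" by (simp flip: ln_mult_pos)
  then show "160943790/10^8 \<le> ln (5::real)" "ln (5::real) \<le> 160943795/10^8"
    using ln_2_bounds ln_approx_bounds[of "5/4" 5] by (simp_all add: eval_nat_numeral)
qed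

lemma ln_7_bounds: "194591013/10^8 \<le> ln (7::real)" "ln (7::real) \<le> 194591020/10^8"
proof -
  have "ln (7::real) + ln (8/7) = ln 2 + ln 2 + ln 2" by (simp flip: ln_mult_pos)
  then show "194591013/10^8 \<le> ln (7::real)" "ln (7::real) \<le> 194591020/10^8"
    using ln_2_bounds ln_approx_bounds[of "8/7" 4] by (simp_all add: eval_nat_numeral)
qed

lemma ln_composite:
  "ln (4::real) = 2 * ln 2" "ln (6::real) = ln 2 + ln 3" "ln (8::real) = 3 * ln 2"
  "ln (9::real) = 2 * ln 3" "ln (10::real) = ln 2 + ln 5"
  using ln_realpow[of 2 2] ln_realpow[of 2 3] ln_realpow[of 3 2] ln_mult[of 2 3] ln_mult[of 2 5] by auto

text \<open>
  Euler--Maclaurin for ln^k x / x, started at 10.  The terms with \<open>bern 3\<close> and \<open>bern 5\<close> are absent because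
  these polynomials vanish at integers.
\<close>

lemma stieltjes_lim_approx:
  defines "\<phi> \<equiv> \<lambda>k i. if i = k then fact k else (0::real)"
  shows "\<bar>stieltjes_lim k - ((\<Sum>n\<in>{0<..10}. ln (real n) ^ k / real n) - ln 10 ^ Suc k / real (Suc k)
     - logpoly k (deriv_coeff 0 (\<phi> k)) (ln 10) / 20 - logpoly k (deriv_coeff 1 (\<phi> k)) (ln 10) / 1200
     + logpoly k (deriv_coeff 3 (\<phi> k)) (ln 10) / 7200000)\<bar>
   \<le> logpoly k (majorant_coeff k (deriv_coeff 5 (\<phi> k))) (ln 10) / 420000000"
proof -
  have 1: "logpoly k (\<phi> k) w = w ^ k" for w
    unfolding \<phi>_def by (rule logpoly_monomial)
  have 2: "logpoly_primitive k (\<phi> k) w = w ^ Suc k / real (Suc k)" for w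
    unfolding \<phi>_def by (rule logpoly_primitive_monomial)
  let ?S = "\<Sum>n\<in>{0<..10}. ln (real n) ^ k / real n"
  have main: "\<bar>(stieltjes_lim k - ?S) - (em_bdry (logpoly_deriv_seq k (\<phi> k) 0) (10 - real 10) 10
         - logpoly_primitive k (\<phi> k) (ln 10 - 0))\<bar>
     \<le> (logpoly k (majorant_coeff k (deriv_coeff 5 (\<phi> k))) (ln 10 - 0) / 10 ^ 5) / 4200"
  proof (rule logpoly_sum_limit)
    have "(\<lambda>N. (\<Sum>n\<in>{0<..N}. ln (real n) ^ k / real n) - ln (real N) ^ Suc k / real (Suc k) - ?S) \<longlonglongrightarrow> stieltjes_lim k - ?S"
      by (intro tendsto_intros stieltjes_lim_limit)
    then show "(\<lambda>N. (\<Sum>n\<in>{10<..N}. logpoly_deriv_seq k (\<phi> k) 0 0 (real n))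
        - logpoly_primitive k (\<phi> k) (ln (real N) - 0)) \<longlonglongrightarrow> stieltjes_lim k - ?S"
    proof (rule Lim_transform_eventually)
      show "\<forall>\<^sub>F N in sequentially. (\<Sum>n\<in>{0<..N}. ln (real n) ^ k / real n) - ln (real N) ^ Suc k / real (Suc k) - ?S
          = (\<Sum>n\<in>{10<..N}. logpoly_deriv_seq k (\<phi> k) 0 0 (real n)) - logpoly_primitive k (\<phi> k) (ln (real N) - 0)"
        using eventually_ge_at_top[of "10::nat"]
      proof eventually_elim
        case (elim N)
        have "(\<Sum>n\<in>{0<..N}. ln (real n) ^ k / real n) = ?S + (\<Sum>n\<in>{10<..N}. ln (real n) ^ k / real n)"
          using elim by (subst sum.union_disjoint[symmetric]) (auto intro!: sum.cong)
        then show ?case by (simp add: 2 logpoly_deriv_seq_def 1)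
      qed
    qed
  qed (auto simp: \<phi>_def)
  have "em_bdry (logpoly_deriv_seq k (\<phi> k) 0) (10 - real 10) 10
      = - logpoly k (\<phi> k) (ln 10) / 20 - logpoly k (deriv_coeff 1 (\<phi> k)) (ln 10) / 1200
        + logpoly k (deriv_coeff 3 (\<phi> k)) (ln 10) / 7200000"
    by (simp add: em_bdry_def logpoly_deriv_seq_def eval_nat_numeral lessThan_Suc del: deriv_coeff.simps)
  then have "stieltjes_lim k - (?S - ln 10 ^ Suc k / real (Suc k)
       - logpoly k (deriv_coeff 0 (\<phi> k)) (ln 10) / 20 - logpoly k (deriv_coeff 1 (\<phi> k)) (ln 10) / 1200
       + logpoly k (deriv_coeff 3 (\<phi> k)) (ln 10) / 7200000)
    = (stieltjes_lim k - ?S) - (em_bdry (logpoly_deriv_seq k (\<phi> k) 0) (10 - real 10) 10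
         - logpoly_primitive k (\<phi> k) (ln 10 - 0))"
    unfolding 2 deriv_coeff_0_eq diff_zero by linarith
  with main show ?thesis by (simp only:) simp
qed

lemma ln_upto_10_bounds:
  fixes k :: nat
  shows "(69314718/10^8) ^ k \<le> ln (2::real) ^ k" "ln (2::real) ^ k \<le> (69314719/10^8) ^ k"
    "(109861228/10^8) ^ k \<le> ln (3::real) ^ k" "ln (3::real) ^ k \<le> (109861230/10^8) ^ k"
    "(138629436/10^8) ^ k \<le> ln (4::real) ^ k" "ln (4::real) ^ k \<le> (138629438/10^8) ^ k"
    "(160943790/10^8) ^ k \<le> ln (5::real) ^ k" "ln (5::real) ^ k \<le> (160943795/10^8) ^ k"
    "(179175946/10^8) ^ k \<le> ln (6::real) ^ k" "ln (6::real) ^ k \<le> (179175949/10^8) ^ k"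
    "(194591013/10^8) ^ k \<le> ln (7::real) ^ k" "ln (7::real) ^ k \<le> (194591020/10^8) ^ k"
    "(207944154/10^8) ^ k \<le> ln (8::real) ^ k" "ln (8::real) ^ k \<le> (207944157/10^8) ^ k"
    "(219722456/10^8) ^ k \<le> ln (9::real) ^ k" "ln (9::real) ^ k \<le> (219722460/10^8) ^ k"
    "(230258508/10^8) ^ k \<le> ln (10::real) ^ k" "ln (10::real) ^ k \<le> (230258514/10^8) ^ k"
  by (intro power_mono; use ln_2_bounds ln_3_bounds ln_5_bounds ln_7_bounds in \<open>simp add: ln_composite\<close>)+

lemma majorant_coeff_step: "majorant_coeff d \<psi> i = (if i \<le> d then (\<bar>\<psi> i\<bar> + majorant_coeff d \<psi> (Suc i)) / 5 else 0)"
  using majorant_coeff_rec[of i d \<psi>] by (auto simp: majorant_coeff_def[of _ _ i])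

lemma deriv_coeff_numeral:
  "deriv_coeff (numeral n) \<phi> i = deriv_coeff (pred_numeral n) \<phi> (Suc i) - numeral n * deriv_coeff (pred_numeral n) \<phi> i"
proof -
  have "real (Suc (pred_numeral n)) = numeral n" by (metis numeral_eq_Suc of_nat_numeral)
  then show ?thesis by (subst numeral_eq_Suc) (simp del: of_nat_Suc)
qed

lemma sum_upto_10: "(\<Sum>n\<in>{0<..10}. g n) = g 1 + g 2 + g 3 + g 4 + g 5 + g 6 + g 7 + g 8 + g 9 + g (10::nat)"
  for g :: "nat \<Rightarrow> real"
proof -
  have "{0<..10::nat} = {1,2,3,4,5,6,7,8,9,10}" by (auto; presburger)
  then show ?thesis by (simp add: add_ac)
qed

text \<open>
  In the next five lemmas every power of a logarithm is an independent unknown with known bounds, so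
  that each claim is a linear problem; the radii cover the Euler--Maclaurin error and the rounding of
  the logarithms.  The rule \<open>power_mono_iff\<close> is disabled because it would turn the bounds on powers
  back into bounds on logarithms.
\<close>

lemma stieltjes_lim_1_bounds: "-728158/10000000 - 1/1000000 \<le> stieltjes_lim 1" "stieltjes_lim 1
    \<le> -728158/10000000 + 1/1000000"
proof -
  note [simp] = sum_upto_10 logpoly_def majorant_coeff_step deriv_coeff_numeral atMost_nat_numeral fact_numeral
    add_divide_distrib diff_divide_distrib power_divide
  note approx = stieltjes_lim_approx[of 1, unfolded abs_le_iff]
  note [simp del] = power_mono_iff
  note facts = approx[THEN conjunct1, simplified] approx[THEN conjunct2, simplified]
      ln_upto_10_bounds[of 1, unfolded power_one_right, simplified]
    ln_upto_10_bounds(17,18)[of 2, unfolded power2_eq_square, simplified]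
  show "-728158/10000000 - 1/1000000 \<le> stieltjes_lim 1" using facts unfolding One_nat_def by linarith
  show "stieltjes_lim 1 \<le> -728158/10000000 + 1/1000000" using facts unfolding One_nat_def by linarith
qed

lemma stieltjes_lim_2_bounds: "-96904/10000000 - 2/1000000 \<le> stieltjes_lim 2" "stieltjes_lim 2
    \<le> -96904/10000000 + 2/1000000"
proof -
  note [simp] = sum_upto_10 logpoly_def majorant_coeff_step deriv_coeff_numeral atMost_nat_numeral fact_numeral
    add_divide_distrib diff_divide_distrib power_divide
  note approx = stieltjes_lim_approx[of 2, unfolded abs_le_iff]
  note [simp del] = power_mono_iff
  note facts = approx[THEN conjunct1, simplified] approx[THEN conjunct2, simplified]
      ln_upto_10_bounds[of 2, simplified] ln_upto_10_bounds(17,18)[of 1, unfolded power_one_right, simplified]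
    ln_upto_10_bounds(17,18)[of 3, simplified]
  show "-96904/10000000 - 2/1000000 \<le> stieltjes_lim 2" using facts by linarith
  show "stieltjes_lim 2 \<le> -96904/10000000 + 2/1000000" using facts by linarith
qed

lemma stieltjes_lim_3_bounds: "20538/10000000 - 6/1000000 \<le> stieltjes_lim 3" "stieltjes_lim 3
    \<le> 20538/10000000 + 6/1000000"
proof -
  note [simp] = sum_upto_10 logpoly_def majorant_coeff_step deriv_coeff_numeral atMost_nat_numeral fact_numeral
    add_divide_distrib diff_divide_distrib power_divide
  note approx = stieltjes_lim_approx[of 3, unfolded abs_le_iff]
  note [simp del] = power_mono_iff
  note facts = approx[THEN conjunct1, simplified] approx[THEN conjunct2, simplified]
      ln_upto_10_bounds[of 3, simplified] ln_upto_10_bounds(17,18)[of 1, unfolded power_one_right, simplified]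
    ln_upto_10_bounds(17,18)[of 2, simplified] ln_upto_10_bounds(17,18)[of 4, simplified]
  show "20538/10000000 - 6/1000000 \<le> stieltjes_lim 3" using facts by linarith
  show "stieltjes_lim 3 \<le> 20538/10000000 + 6/1000000" using facts by linarith
qed

lemma stieltjes_lim_4_bounds: "23254/10000000 - 25/1000000 \<le> stieltjes_lim 4" "stieltjes_lim 4
    \<le> 23254/10000000 + 25/1000000"
proof -
  note [simp] = sum_upto_10 logpoly_def majorant_coeff_step deriv_coeff_numeral atMost_nat_numeral fact_numeral
    add_divide_distrib diff_divide_distrib power_divide
  note approx = stieltjes_lim_approx[of 4, unfolded abs_le_iff]
  note [simp del] = power_mono_iff
  note facts = approx[THEN conjunct1, simplified] approx[THEN conjunct2, simplified]
      ln_upto_10_bounds[of 4, simplified] ln_upto_10_bounds(17,18)[of 1, unfolded power_one_right, simplified]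
    ln_upto_10_bounds(17,18)[of 2, simplified] ln_upto_10_bounds(17,18)[of 3, simplified]
        ln_upto_10_bounds(17,18)[of 5, simplified]
  show "23254/10000000 - 25/1000000 \<le> stieltjes_lim 4" using facts by linarith
  show "stieltjes_lim 4 \<le> 23254/10000000 + 25/1000000" using facts by linarith
qed

lemma stieltjes_lim_5_bounds: "7933/10000000 - 1/10000 \<le> stieltjes_lim 5" "stieltjes_lim 5 \<le> 7933/10000000 + 1/10000"
proof -
  note [simp] = sum_upto_10 logpoly_def majorant_coeff_step deriv_coeff_numeral atMost_nat_numeral fact_numeral
    add_divide_distrib diff_divide_distrib power_divide
  note approx = stieltjes_lim_approx[of 5, unfolded abs_le_iff]
  note [simp del] = power_mono_iff
  note facts = approx[THEN conjunct1, simplified] approx[THEN conjunct2, simplified]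
      ln_upto_10_bounds[of 5, simplified] ln_upto_10_bounds(17,18)[of 1, unfolded power_one_right, simplified]
    ln_upto_10_bounds(17,18)[of 2, simplified] ln_upto_10_bounds(17,18)[of 3, simplified]
        ln_upto_10_bounds(17,18)[of 4, simplified] ln_upto_10_bounds(17,18)[of 6, simplified]
  show "7933/10000000 - 1/10000 \<le> stieltjes_lim 5" using facts by linarith
  show "stieltjes_lim 5 \<le> 7933/10000000 + 1/10000" using facts by linarith
qed

section \<open>Size of the remainders\<close>

lemma abs_bern3_le:
  assumes "0 \<le> u" "u \<le> 1"
  shows "\<bar>bern 3 u\<bar> \<le> 1/120"
proof -
  define y where "y = u * (1 - u)"
  have y0: "0 \<le> y" using assms by (simp add: y_def)
  have "(6 * bern 3 u)\<^sup>2 = y\<^sup>2 * (1/4 - y)"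
    by (simp add: bern_eqs y_def field_simps power2_eq_square power3_eq_cube)
  also have "1/432 - y\<^sup>2 * (1/4 - y) = (y - 1/6)\<^sup>2 * (y + 1/12)"
    by (simp add: power2_eq_square algebra_simps)
  then have "y\<^sup>2 * (1/4 - y) \<le> 1/432"
    using y0 by (smt (verit) mult_nonneg_nonneg zero_le_power2 divide_nonneg_nonneg)
  also have "\<dots> \<le> (1/20)\<^sup>2" by (simp add: power2_eq_square)
  finally have "\<bar>6 * bern 3 u\<bar> \<le> \<bar>1/20\<bar>"
    by (simp only: abs_le_square_iff)
  then show ?thesis by simp
qed

lemma abs_bern4_le:
  assumes "0 \<le> u" "u \<le> 1"
  shows "\<bar>bern 4 u\<bar> \<le> 1/720"
proof -
  define y where "y = u * (1 - u)"
  have y0: "0 \<le> y" using assms by (simp add: y_def)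
  have y1: "y \<le> 1/4"
    using zero_le_power2[of "u - 1/2"] by (simp add: y_def power2_eq_square algebra_simps)
  have "bern 4 u = y\<^sup>2 / 24 - 1/720"
    by (simp add: bern_eqs y_def) algebra
  moreover have "y\<^sup>2 \<le> (1/4)\<^sup>2" using y0 y1 by (intro power_mono)
  ultimately show ?thesis using zero_le_power2[of y] unfolding abs_le_iff power2_eq_square by simp
qed

lemma abs_bern_frac_le:
  "\<bar>bern 3 (frac x)\<bar> \<le> 1/120" "\<bar>bern 4 (frac x)\<bar> \<le> 1/720" "\<bar>bern 5 (frac x)\<bar> \<le> 1/4200"
  by (intro abs_bern3_le abs_bern4_le abs_bern5_le; simp add: frac_lt_1 less_imp_le)+

text \<open>
  The summand vanishes to order p at e^t, so the boundary terms start with the one for \<open>bern (p+1)\<close>.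
  The rest comes from the dominating function, with the triangle inequality applied to each of
  its coefficients, which are linear in t.
\<close>

lemma
  fixes t y :: real
  assumes t: "t \<ge> 0"
  defines "y \<equiv> exp t"
  shows remainder_2_bound: "\<bar>remainder 2 t\<bar> \<le> t / y^3 / 120 + (6 * t + 3) / y^4 / 720
            + (95 * t + 120) / y^5 / 4200" (is ?th2)
    and remainder_3_bound: "\<bar>remainder 3 t\<bar> \<le> t / y^4 / 720 + (40 * t + 40) / y^5 / 4200" (is ?th3)
    and remainder_4_bound: "\<bar>remainder 4 t\<bar> \<le> (10 * t + 10) / y^5 / 4200" (is ?th4)
proof -
  note [simp] = kernel_coeff_def majorant_coeff_step deriv_coeff_numeral
  have y: "y > 0" by (simp add: y_def)
  have tri: "\<bar>b + a * t\<bar> \<le> \<bar>b\<bar> + \<bar>a\<bar> * t" for a b :: real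
    using abs_triangle_ineq[of b "a * t"] t by (simp add: abs_mult)
  have e3: "\<bar>bern 3 (frac y) * (a / y ^ 3)\<bar> \<le> \<bar>a\<bar> / y^3 / 120" for a
    using mult_right_mono[OF abs_bern_frac_le(1)[of y], of "\<bar>a\<bar> / y^3"] y by (simp add: abs_mult)
  have e4: "\<bar>bern 4 (frac y) * (a / y ^ 4)\<bar> \<le> \<bar>a\<bar> / y^4 / 720" for a
    using mult_right_mono[OF abs_bern_frac_le(2)[of y], of "\<bar>a\<bar> / y^4"] y by (simp add: abs_mult)
  have e5: "\<bar>bern 5 (frac y) * (a / y ^ 5)\<bar> \<le> \<bar>a\<bar> / y^5 / 4200" for a
    using mult_right_mono[OF abs_bern_frac_le(3)[of y], of "\<bar>a\<bar> / y^5"] y by (simp add: abs_mult)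
  have sum5: "(\<Sum>j<5. (-1) ^ j * bern (Suc j) u * (f j / y ^ Suc j))
     = bern 1 u * (f 0 / y) - bern 2 u * (f 1 / y^2) + bern 3 u * (f 2 / y^3) - bern 4 u * (f 3 / y^4)
       + bern 5 u * (f 4 / y^5)" for u f
    by (simp add: eval_nat_numeral lessThan_Suc del: bern.simps(2-))
  note em = remainder_euler_maclaurin[OF t, folded y_def, unfolded sum5]
  have pos: "a \<le> b \<Longrightarrow> a / y ^ k / 4200 \<le> b / y ^ k / 4200" "a \<le> b \<Longrightarrow> a / y ^ k / 720 \<le> b / y ^ k / 720" for a b k
    using y by (simp_all add: divide_right_mono)
  have comb: "\<bar>R\<bar> \<le> a + b + c + m"
    if "\<bar>R - (A - B + C)\<bar> \<le> m'" "m' \<le> m" "\<bar>A\<bar> \<le> a" "\<bar>B\<bar> \<le> b'" "b' \<le> b" "\<bar>C\<bar> \<le> c'" "c' \<le> c"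
    for R A B C a b b' c c' m m' :: real
    using that by linarith
  show ?th2
  proof -
    have em2: "\<bar>remainder 2 t - (bern 3 (frac y) * (t / y^3) - bern 4 (frac y) * ((3 - 6 * t) / y^4)
             + bern 5 (frac y) * ((35 * t - 30) / y^5))\<bar>
        \<le> majorant_coeff (Suc 2) (deriv_coeff 5 (kernel_coeff 2 t)) 0 / y ^ 5 / 4200"
      using em[of 2] by (simp add: algebra_simps)
    have maj2: "majorant_coeff (Suc 2) (deriv_coeff 5 (kernel_coeff 2 t)) 0 / y ^ 5 / 4200 \<le> (60 * t + 90) / y ^ 5 / 4200"
    proof (rule pos)
      have "majorant_coeff (Suc 2) (deriv_coeff 5 (kernel_coeff 2 t)) 0
          = \<bar>255 - 225 * t\<bar> / 5 + \<bar>274 * t - 675\<bar> / 25 + \<bar>822 - 120 * t\<bar> / 125 + 360 / 625"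
        by (simp add: algebra_simps abs_minus_commute)
      also have "\<dots> \<le> (255 + 225 * t) / 5 + (675 + 274 * t) / 25 + (822 + 120 * t) / 125 + 360 / 625"
        by (intro add_mono divide_right_mono order.refl tri[of "255" "-225", simplified]
            tri[of "-675" "274", simplified] tri[of "822" "-120", simplified]) simp_all
      also have "\<dots> \<le> 60 * t + 90" using t by (simp add: add_divide_distrib)
      finally show "majorant_coeff (Suc 2) (deriv_coeff 5 (kernel_coeff 2 t)) 0 \<le> 60 * t + 90" .
    qed
    have "\<bar>3 - 6 * t\<bar> / y ^ 4 / 720 \<le> (6 * t + 3) / y ^ 4 / 720"
      "\<bar>35 * t - 30\<bar> / y ^ 5 / 4200 \<le> (35 * t + 30) / y ^ 5 / 4200"
      using t by (intro pos; simp add: abs_le_iff)+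
    from comb[OF em2 maj2 e3 e4 this(1) e5 this(2)] show ?thesis
      using t by (simp add: add_divide_distrib)
  qed
  show ?th3
  proof -
    have em3: "\<bar>- remainder 3 t - (0 - bern 4 (frac y) * (t / y^4)
             + bern 5 (frac y) * ((4 - 10 * t) / y^5))\<bar>
        \<le> majorant_coeff (Suc 3) (deriv_coeff 5 (kernel_coeff 3 t)) 0 / y ^ 5 / 4200"
      using em[of 3] by (simp add: algebra_simps)
    have maj3: "majorant_coeff (Suc 3) (deriv_coeff 5 (kernel_coeff 3 t)) 0 / y ^ 5 / 4200 \<le> (30 * t + 36) / y ^ 5 / 4200"
    proof (rule pos)
      have "majorant_coeff (Suc 3) (deriv_coeff 5 (kernel_coeff 3 t)) 0
          = \<bar>85 * t - 60\<bar> / 5 + \<bar>340 - 225 * t\<bar> / 25 + \<bar>274 * t - 900\<bar> / 125 + \<bar>1096 - 120 * t\<bar> / 625 + 480 / 3125"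
        by (simp add: algebra_simps abs_minus_commute)
      also have "\<dots> \<le> (60 + 85 * t) / 5 + (340 + 225 * t) / 25 + (900 + 274 * t) / 125 + (1096 + 120 * t) / 625 +
          480 / 3125"
        by (intro add_mono divide_right_mono order.refl tri[of "-60" "85", simplified]
            tri[of "340" "-225", simplified] tri[of "-900" "274", simplified] tri[of "1096" "-120", simplified]) simp_all
      also have "\<dots> \<le> 30 * t + 36" using t by (simp add: add_divide_distrib)
      finally show "majorant_coeff (Suc 3) (deriv_coeff 5 (kernel_coeff 3 t)) 0 \<le> 30 * t + 36" .
    qed
    have "\<bar>4 - 10 * t\<bar> / y ^ 5 / 4200 \<le> (10 * t + 4) / y ^ 5 / 4200"
      using t by (intro pos; simp add: abs_le_iff)
    from comb[OF em3 maj3 _ e4 order.refl e5 this, of 0] show ?thesis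
      using t by (simp add: add_divide_distrib)
  qed
  show ?th4
  proof -
    have em4: "\<bar>remainder 4 t - (0 - 0 + bern 5 (frac y) * (t / y^5))\<bar>
        \<le> majorant_coeff (Suc 4) (deriv_coeff 5 (kernel_coeff 4 t)) 0 / y ^ 5 / 4200"
      using em[of 4] by (simp add: algebra_simps)
    have maj4: "majorant_coeff (Suc 4) (deriv_coeff 5 (kernel_coeff 4 t)) 0 / y ^ 5 / 4200 \<le> (9 * t + 10) / y ^ 5 / 4200"
    proof (rule pos)
      have "majorant_coeff (Suc 4) (deriv_coeff 5 (kernel_coeff 4 t)) 0
          = \<bar>5 - 15 * t\<bar> / 5 + \<bar>85 * t - 75\<bar> / 25 + \<bar>425 - 225 * t\<bar> / 125 + \<bar>274 * t - 1125\<bar> / 625 + \<bar>1370 - 120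
              * t\<bar> / 3125 + 600 / 15625"
        by (simp add: algebra_simps abs_minus_commute)
      also have "\<dots> \<le> (5 + 15 * t) / 5 + (75 + 85 * t) / 25 + (425 + 225 * t) / 125 + (1125 + 274 * t) / 625 +
          (1370 + 120 * t) / 3125 + 600 / 15625"
        by (intro add_mono divide_right_mono order.refl tri[of "5" "-15", simplified]
            tri[of "-75" "85", simplified] tri[of "425" "-225", simplified] tri[of "-1125" "274", simplified]
            tri[of "1370" "-120", simplified]) simp_all
      also have "\<dots> \<le> 9 * t + 10" using t by (simp add: add_divide_distrib)
      finally show "majorant_coeff (Suc 4) (deriv_coeff 5 (kernel_coeff 4 t)) 0 \<le> 9 * t + 10" .
    qed
    from comb[OF em4 maj4 _ _ order.refl e5 order.refl, of 0 0] show ?thesis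
      using t by (simp add: add_divide_distrib)
  qed
qed

section \<open>Signs of the two kernels\<close>

text \<open>
  Its Laplace transform is (F(h) (1 + \<beta> h + c h^2) - \<alpha>) / h^5, where F(h) = \<zeta>'(1 + h) + 1/h^2.
\<close>

definition kernel :: "real \<Rightarrow> real \<Rightarrow> real \<Rightarrow> real \<Rightarrow> real" where
  "kernel \<alpha> \<beta> c t = defect 4 t + \<beta> * defect 3 t + c * defect 2 t - \<alpha> * t ^ 4 / 24"

lemma defect_first_interval:
  assumes "0 \<le> t" "t < ln 2"
  shows "defect p t = t ^ (p + 2) / fact (p + 2)"
proof -
  have "exp t < exp (ln 2)" "exp t \<ge> 1" using assms by (simp_all only: exp_less_cancel_iff one_le_exp_iff)
  then have "exp t < 2" "exp t \<ge> 1" by simp_all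
  then have "nat \<lfloor>exp t\<rfloor> = 1" by linarith
  moreover have "{0<..1::nat} = {1}" by auto
  ultimately show ?thesis by (simp add: defect_def)
qed

lemma defect_second_interval:
  assumes "ln 2 \<le> t" "t < ln 3"
  shows "defect p t = t ^ (p + 2) / fact (p + 2) - ln 2 / 2 * ((t - ln 2) ^ p / fact p)"
proof -
  have "exp t < exp (ln 3)" "exp t \<ge> exp (ln 2)" using assms by (simp_all only: exp_less_cancel_iff exp_le_cancel_iff)
  then have "nat \<lfloor>exp t\<rfloor> = 2" by simp linarith
  moreover have "{0<..2::nat} = {1, 2}" by auto
  ultimately show ?thesis by (simp add: defect_def)
qed

lemma defect_eq_remainder:
  "defect p t = (\<Sum>j\<le>p. taylor_coeff j * t ^ (p - j) / fact (p - j)) + remainder p t"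
  by (simp add: remainder_def)

text \<open>
  The three parameters of the theorem, with the limits \<open>stieltjes_lim\<close> in place of the Laurent
  coefficients.
\<close>

locale stieltjes_params =
  fixes \<alpha> \<beta> \<delta> :: real
  assumes \<alpha>_def: "\<alpha> = - stieltjes_lim 1"
    and \<beta>_def: "\<beta> = stieltjes_lim 2 / stieltjes_lim 1"
    and \<delta>_def: "\<delta> = (stieltjes_lim 2 / stieltjes_lim 1)\<^sup>2 - stieltjes_lim 3 / (2 * stieltjes_lim 1)"
begin

lemma \<alpha>_bounds: "728148/10000000 \<le> \<alpha>" "\<alpha> \<le> 728168/10000000"
  using stieltjes_lim_1_bounds by (simp_all add: \<alpha>_def)

lemma \<beta>_bounds: "13305/100000 \<le> \<beta>" "\<beta> \<le> 13312/100000"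
proof -
  have "\<beta> = (- stieltjes_lim 2) / \<alpha>" by (simp add: \<alpha>_def \<beta>_def)
  moreover have "13305/100000 * \<alpha> \<le> - stieltjes_lim 2" "- stieltjes_lim 2 \<le> 13312/100000 * \<alpha>" "0 < \<alpha>"
    using stieltjes_lim_2_bounds \<alpha>_bounds by simp_all
  ultimately show "13305/100000 \<le> \<beta>" "\<beta> \<le> 13312/100000"
    using pos_le_divide_eq[of \<alpha> "13305/100000" "- stieltjes_lim 2"]
        pos_divide_le_eq[of \<alpha> "- stieltjes_lim 2" "13312/100000"]
    by simp_all
qed

lemma \<beta>_sq_bounds: "13305/100000 * (13305/100000) \<le> \<beta>\<^sup>2" "\<beta>\<^sup>2 \<le> 13312/100000 * (13312/100000)"
  unfolding power2_eq_square using \<beta>_bounds by (intro mult_mono; simp)+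

lemma \<delta>_bounds: "3175/100000 \<le> \<delta>" "\<delta> \<le> 3188/100000"
proof -
  have \<delta>: "\<delta> = \<beta>\<^sup>2 + stieltjes_lim 3 / (2 * \<alpha>)" by (simp add: \<alpha>_def \<beta>_def \<delta>_def)
  have "stieltjes_lim 3 / (2 * \<alpha>) \<le> 14145/1000000" "14060/1000000 \<le> stieltjes_lim 3 / (2 * \<alpha>)"
    using stieltjes_lim_3_bounds \<alpha>_bounds by (simp_all add: field_simps)
  then show "3175/100000 \<le> \<delta>" "\<delta> \<le> 3188/100000"
    unfolding \<delta> using \<beta>_sq_bounds by simp_all
qed

lemma taylor_coeff_eqs:
  "taylor_coeff 0 = \<alpha>" "taylor_coeff 1 = - \<alpha> * \<beta>" "taylor_coeff 2 = \<alpha> * (\<beta>\<^sup>2 - \<delta>)"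
  "taylor_coeff 3 = stieltjes_lim 4 / 6" "taylor_coeff 4 = - stieltjes_lim 5 / 24"
  using \<alpha>_bounds
  by (auto simp: taylor_coeff_def \<alpha>_def \<beta>_def \<delta>_def eval_nat_numeral)

lemma taylor_coeff_bounds:
  "- 96924/10000000 \<le> taylor_coeff 1" "taylor_coeff 1 \<le> - 96884/10000000"
  "- 10299/10000000 \<le> taylor_coeff 2" "taylor_coeff 2 \<le> - 10239/10000000"
  "38338/100000000 \<le> taylor_coeff 3" "taylor_coeff 3 \<le> 39174/100000000"
  "- 3723/100000000 \<le> taylor_coeff 4" "taylor_coeff 4 \<le> - 2888/100000000"
  using stieltjes_lim_2_bounds stieltjes_lim_3_bounds stieltjes_lim_4_bounds stieltjes_lim_5_bounds
  by (simp_all add: taylor_coeff_def eval_nat_numeral)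

text \<open>
  The powers t^4 and t^3 cancel because the first two Taylor coefficients are \<alpha> and - \<alpha> \<beta>.
\<close>

lemma kernel_eq_remainder:
  "kernel \<alpha> \<beta> c t = (taylor_coeff 2 + \<beta> * taylor_coeff 1 + c * \<alpha>) * t\<^sup>2 / 2
     + (taylor_coeff 3 + \<beta> * taylor_coeff 2 + c * taylor_coeff 1) * t +
         (taylor_coeff 4 + \<beta> * taylor_coeff 3 + c * taylor_coeff 2)
     + (remainder 4 t + \<beta> * remainder 3 t + c * remainder 2 t)"
  unfolding kernel_def defect_eq_remainder
  by (simp add: atMost_nat_numeral fact_numeral taylor_coeff_eqs(1) taylor_coeff_eqs(2)[unfolded One_nat_def]
      algebra_simps add_divide_distrib diff_divide_distrib)

lemma remainder_tail:
  assumes t: "t \<ge> ln 3" and c: "0 \<le> c"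
  shows "\<bar>remainder 4 t + \<beta> * remainder 3 t + c * remainder 2 t\<bar>
      \<le> 178/10000000 * t + 152/10000000 + c * (506/1000000 * t + 171/1000000)"
proof -
  have t0: "t \<ge> 0" using t ln_3_bounds by linarith
  have y: "exp t \<ge> 3" using t by (metis exp_le_cancel_iff exp_ln zero_less_numeral)
  have div: "a / exp t ^ k \<le> a / 3 ^ k" if "a \<ge> 0" for a k
    using that y by (intro divide_left_mono power_mono) auto
  have "\<bar>remainder 2 t\<bar> \<le> t / 3^3 / 120 + (6 * t + 3) / 3^4 / 720 + (95 * t + 120) / 3^5 / 4200"
    by (rule order.trans[OF remainder_2_bound[OF t0]], intro add_mono divide_right_mono div) (use t0 in auto)
  also have "\<dots> \<le> (506 * t + 171) / 1000000" using t0 by (simp add: add_divide_distrib)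
  finally have r2: "\<bar>remainder 2 t\<bar> \<le> \<dots>" .
  have "\<bar>remainder 3 t\<bar> \<le> t / 3^4 / 720 + (40 * t + 40) / 3^5 / 4200"
    by (rule order.trans[OF remainder_3_bound[OF t0]], intro add_mono divide_right_mono div) (use t0 in auto)
  also have "\<dots> \<le> (57 * t + 40) / 1000000" using t0 by (simp add: add_divide_distrib)
  finally have r3: "\<bar>remainder 3 t\<bar> \<le> \<dots>" .
  have "\<bar>remainder 4 t\<bar> \<le> (10 * t + 10) / 3^5 / 4200"
    by (rule order.trans[OF remainder_4_bound[OF t0]], intro divide_right_mono div) (use t0 in auto)
  also have "\<dots> \<le> (98 * t + 98) / 10000000" using t0 by (simp add: add_divide_distrib)
  finally have r4: "\<bar>remainder 4 t\<bar> \<le> \<dots>" .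
  have "\<bar>\<beta> * remainder 3 t\<bar> \<le> 13312/100000 * ((57 * t + 40) / 1000000)"
    unfolding abs_mult using r3 \<beta>_bounds t0 by (intro mult_mono) auto
  also have "\<dots> \<le> (80 * t + 54) / 10000000" using t0 by (simp add: add_divide_distrib)
  finally have "\<bar>\<beta> * remainder 3 t\<bar> \<le> \<dots>" .
  moreover have "\<bar>c * remainder 2 t\<bar> \<le> c * ((506 * t + 171) / 1000000)"
    unfolding abs_mult using mult_left_mono[OF r2 c] c by simp
  ultimately have "\<bar>remainder 4 t + \<beta> * remainder 3 t + c * remainder 2 t\<bar>
     \<le> (98 * t + 98) / 10000000 + (80 * t + 54) / 10000000 + c * ((506 * t + 171) / 1000000)"
    using r4 by linarith
  then show ?thesis by (simp add: add_divide_distrib)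
qed

text \<open>
  For c = \<delta> the quadratic term vanishes as well.  The remaining line has slope about -5.7e-5 and
  constant term about -1.4e-5, against remainders of total size below 6e-5 at t = ln 3.  This narrow
  margin dictates the accuracy needed everywhere else.
\<close>

lemma kernel_\<delta>_neg_tail:
  assumes t: "t \<ge> ln 3"
  shows "kernel \<alpha> \<beta> \<delta> t < 0"
proof -
  have t1: "t \<ge> 109861228/100000000" using t ln_3_bounds by simp
  have "\<beta> * (- taylor_coeff 2) \<ge> 13305/100000 * (10239/10000000)" "\<delta> * (- taylor_coeff 1) \<ge> 3175/100000 *
      (96884/10000000)"
    "\<beta> * taylor_coeff 3 \<le> 13312/100000 * (39174/100000000)" "\<delta> * (- taylor_coeff 2) \<ge> 3175/100000 * (10239/10000000)"
    using \<beta>_bounds \<delta>_bounds taylor_coeff_bounds by (intro mult_mono; simp)+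
  then have c: "taylor_coeff 3 + \<beta> * taylor_coeff 2 + \<delta> * taylor_coeff 1 \<le> - 52/1000000"
    "taylor_coeff 4 + \<beta> * taylor_coeff 3 + \<delta> * taylor_coeff 2 \<le> - 9/1000000"
    using taylor_coeff_bounds by simp_all
  have q: "taylor_coeff 2 + \<beta> * taylor_coeff 1 + \<delta> * \<alpha> = 0"
    unfolding taylor_coeff_eqs by (simp add: power2_eq_square algebra_simps)
  have "(taylor_coeff 3 + \<beta> * taylor_coeff 2 + \<delta> * taylor_coeff 1) * t \<le> - 52/1000000 * t"
    using c t1 by (intro mult_right_mono) auto
  moreover have "\<bar>remainder 4 t + \<beta> * remainder 3 t + \<delta> * remainder 2 t\<bar>
      \<le> 178/10000000 * t + 152/10000000 + \<delta> * (506/1000000 * t + 171/1000000)"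
    using \<delta>_bounds by (intro remainder_tail t) auto
  moreover have "\<delta> * (506/1000000 * t + 171/1000000) \<le> 3188/100000 * (506/1000000 * t + 171/1000000)"
    using \<delta>_bounds t1 by (intro mult_right_mono) auto
  ultimately show ?thesis
    unfolding kernel_eq_remainder q using c(2) t1 by (simp add: add_divide_distrib abs_le_iff)
qed

text \<open>
  Here the quadratic term has the coefficient \<alpha> (\<alpha> - \<delta>) / 2, about 0.0015, and outweighs everything
  else.
\<close>

lemma kernel_\<alpha>_pos_tail:
  assumes t: "t \<ge> ln 3"
  shows "kernel \<alpha> \<beta> \<alpha> t > 0"
proof -
  have t1: "t \<ge> 109861228/100000000" using t ln_3_bounds by simp
  have "\<beta> * (- taylor_coeff 2) \<le> 13312/100000 * (10299/10000000)" "\<alpha> * (- taylor_coeff 1)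
      \<le> 728168/10000000 * (96924/10000000)"
    "\<beta> * taylor_coeff 3 \<ge> 13305/100000 * (38338/100000000)" "\<alpha> * (- taylor_coeff 2) \<le> 728168/10000000 * (10299/10000000)"
    using \<beta>_bounds \<alpha>_bounds taylor_coeff_bounds by (intro mult_mono; simp)+
  then have c: "taylor_coeff 3 + \<beta> * taylor_coeff 2 + \<alpha> * taylor_coeff 1 \<ge> - 47/100000"
    "taylor_coeff 4 + \<beta> * taylor_coeff 3 + \<alpha> * taylor_coeff 2 \<ge> - 7/100000"
    using taylor_coeff_bounds by simp_all
  have q: "taylor_coeff 2 + \<beta> * taylor_coeff 1 + \<alpha> * \<alpha> = \<alpha> * (\<alpha> - \<delta>)"
    unfolding taylor_coeff_eqs by (simp add: power2_eq_square algebra_simps)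
  have "\<alpha> * (\<alpha> - \<delta>) \<ge> 728148/10000000 * (4/100)"
    using \<alpha>_bounds \<delta>_bounds by (intro mult_mono) auto
  then have "\<alpha> * (\<alpha> - \<delta>) * t\<^sup>2 \<ge> 29/10000 * t\<^sup>2"
    by (intro mult_right_mono) auto
  moreover have "t\<^sup>2 \<ge> 109/100 * t" unfolding power2_eq_square
    using t1 by (intro mult_right_mono) auto
  moreover have "(taylor_coeff 3 + \<beta> * taylor_coeff 2 + \<alpha> * taylor_coeff 1) * t \<ge> - 47/100000 * t"
    using c t1 by (intro mult_right_mono) auto
  moreover have "\<bar>remainder 4 t + \<beta> * remainder 3 t + \<alpha> * remainder 2 t\<bar>
      \<le> 178/10000000 * t + 152/10000000 + \<alpha> * (506/1000000 * t + 171/1000000)"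
    using \<alpha>_bounds by (intro remainder_tail t) auto
  moreover have "\<alpha> * (506/1000000 * t + 171/1000000) \<le> 728168/10000000 * (506/1000000 * t + 171/1000000)"
    using \<alpha>_bounds t1 by (intro mult_right_mono) auto
  moreover have "728168/10000000 * (506/1000000 * t + 171/1000000) \<le> 4/100000 * t + 2/100000" using t1 by simp
  ultimately show ?thesis
    unfolding kernel_eq_remainder q using c(2) t1 by linarith
qed

lemma kernel_first_interval:
  assumes "0 \<le> t" "t < ln 2"
  shows "kernel \<alpha> \<beta> c t = t ^ 4 / 24 * (t\<^sup>2 / 30 + \<beta> * t / 5 + c - \<alpha>)"
  by (simp add: kernel_def defect_first_interval[OF assms] fact_numeral field_simps eval_nat_numeral)

lemma kernel_second_interval:
  assumes "ln 2 \<le> t" "t < ln 3"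
  defines "w \<equiv> t - ln 2"
  shows "kernel \<alpha> \<beta> c t = t ^ 6 / 720 + \<beta> * (t ^ 5 / 120 - ln 2 * w ^ 3 / 12) + c * (t ^ 4 / 24 - ln 2 * w\<^sup>2 / 4)
    - \<alpha> * (t ^ 4 / 24) - ln 2 * w ^ 4 / 48"
  unfolding kernel_def defect_second_interval[OF assms(1,2)] w_def[symmetric]
  by (simp add: fact_numeral field_simps)

lemma kernel_\<delta>_neg_first:
  assumes "0 < t" "t < ln 2"
  shows "kernel \<alpha> \<beta> \<delta> t < 0"
proof -
  have t: "t \<le> 7/10" using assms ln_2_bounds by simp
  have "t\<^sup>2 \<le> (7/10)\<^sup>2" using t assms by (intro power_mono) auto
  moreover have "\<beta> * t \<le> 13312/100000 * (7/10)" using \<beta>_bounds t assms by (intro mult_mono) auto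
  ultimately have "t\<^sup>2 / 30 + \<beta> * t / 5 + \<delta> - \<alpha> < 0"
    using \<alpha>_bounds \<delta>_bounds by (simp add: power2_eq_square)
  then show ?thesis
    using assms by (simp add: kernel_first_interval mult_less_0_iff del: times_divide_eq_left)
qed

lemma kernel_\<alpha>_pos_first:
  assumes "0 < t" "t < ln 2"
  shows "kernel \<alpha> \<beta> \<alpha> t > 0"
  using assms \<beta>_bounds by (simp add: kernel_first_interval add_pos_pos)

text \<open>
  The kernel increases with \<beta> and \<delta> and decreases with \<alpha>, so the parameters may be replaced by
  rational bounds.  In the variable w = t - ln 2 this leaves a polynomial of degree six on [0, 0.4055]
  whose maximum is about -4.5e-5.
\<close>

lemma kernel_\<delta>_neg_second:
  assumes t: "ln 2 \<le> t" "t < ln 3"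
  shows "kernel \<alpha> \<beta> \<delta> t < 0"
proof -
  define L w where "L = ln (2::real)" and "w = t - L"
  have w: "0 \<le> w" "w \<le> 4055/10000" and L: "L \<ge> 69/100"
    using t ln_2_bounds ln_3_bounds by (auto simp: w_def L_def)
  have teq: "t = L + w" by (simp add: w_def)
  \<comment> \<open>The arithmetic-geometric mean inequality (L + w)^2 \<ge> 4 L w yields the monotonicity in \<beta> and \<delta>.\<close>
  have t4: "t ^ 4 \<ge> 16 * L\<^sup>2 * w\<^sup>2"
  proof -
    have "(4 * L * w)\<^sup>2 \<le> (t\<^sup>2)\<^sup>2"
      using L w zero_le_power2[of "L - w"]
      by (intro power_mono) (auto simp: teq power2_eq_square algebra_simps)
    then show ?thesis by (simp add: power_mult_distrib)
  qed
  have L2: "L\<^sup>2 \<ge> 69/100 * L" unfolding power2_eq_square using L by (intro mult_right_mono) auto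
  have t4': "t ^ 4 / 24 - L * w\<^sup>2 / 4 \<ge> 0"
  proof -
    have "69/100 * (L * w\<^sup>2) \<le> L\<^sup>2 * w\<^sup>2" "0 \<le> L * w\<^sup>2"
      using mult_right_mono[OF L2, of "w\<^sup>2"] L by (simp_all add: mult.assoc)
    then show ?thesis using t4 by (simp add: mult.assoc)
  qed
  have t5: "t ^ 5 / 120 - L * w ^ 3 / 12 \<ge> 0"
  proof -
    have "16 * L\<^sup>2 * w\<^sup>2 * w \<le> t ^ 4 * t"
      using t4 w L by (intro mult_mono) (auto simp: teq)
    moreover have "L\<^sup>2 * (w\<^sup>2 * w) \<ge> 69/100 * L * (w\<^sup>2 * w)"
      using L2 w by (intro mult_right_mono) auto
    moreover have "L * (w\<^sup>2 * w) \<ge> 0" using L w by auto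
    ultimately show ?thesis by (simp add: eval_nat_numeral algebra_simps)
  qed
  have "kernel \<alpha> \<beta> \<delta> t \<le> t ^ 6 / 720 + 13312/100000 * (t ^ 5 / 120 - L * w ^ 3 / 12)
     + 3188/100000 * (t ^ 4 / 24 - L * w\<^sup>2 / 4) - 728148/10000000 * (t ^ 4 / 24) - L * w ^ 4 / 48"
    unfolding kernel_second_interval[OF t] L_def[symmetric] w_def[symmetric]
    using \<alpha>_bounds \<beta>_bounds \<delta>_bounds t4' t5
    by (intro add_mono diff_mono order.refl mult_right_mono) auto
  also have "\<dots> =
      (L ^ 6 / 720 + 13312/12000000 * L ^ 5 - 409348/240000000 * L ^ 4)
      + (L ^ 5 / 120 + 13312/2400000 * L ^ 4 - 409348/60000000 * L ^ 3) * w
      + (L ^ 4 / 48 + 13312/1200000 * L ^ 3 - 409348/40000000 * L\<^sup>2 - 797/100000 * L) * w\<^sup>2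
      + (L ^ 3 / 36 + 13312/1200000 * L\<^sup>2 - 409348/60000000 * L - 13312/1200000 * L) * w ^ 3
      + (L\<^sup>2 / 48 + 13312/2400000 * L - 409348/240000000 - L / 48) * w ^ 4
      + (L / 120 + 13312/12000000) * w ^ 5 + w ^ 6 / 720"
    unfolding teq by (simp add: eval_nat_numeral field_simps)
  also have "\<dots> \<le> - 62/1000000 + 342/1000000 * w + (- 1937/1000000) * w\<^sup>2 + 2163/1000000 * w ^ 3
      + (- 2292/1000000) * w ^ 4 + 6886/1000000 * w ^ 5 + w ^ 6 / 720"
    using ln_upto_10_bounds(1,2)[of 2, folded L_def, unfolded power_divide]
      ln_upto_10_bounds(1,2)[of 3, folded L_def, unfolded power_divide]
      ln_upto_10_bounds(1,2)[of 4, folded L_def, unfolded power_divide]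
      ln_upto_10_bounds(1,2)[of 5, folded L_def, unfolded power_divide]
      ln_upto_10_bounds(1,2)[of 6, folded L_def, unfolded power_divide] ln_2_bounds[folded L_def] w
    by (intro add_mono mult_right_mono order.refl) (simp_all del: power_mono_iff)
  also have "\<dots> < 0"
  proof -
    have p: "w ^ 3 \<le> 4055/10000 * w\<^sup>2" "w ^ 5 \<le> 4055/10000 * w ^ 4" "w ^ 6 \<le> 1645/10000 * w ^ 4"
      "w ^ 4 \<le> 1645/10000 * w\<^sup>2"
    proof -
      have "w * w\<^sup>2 \<le> 4055/10000 * w\<^sup>2" "w * w ^ 4 \<le> 4055/10000 * w ^ 4"
        "(w * w) * w ^ 4 \<le> 1645/10000 * w ^ 4" "(w * w) * w\<^sup>2 \<le> 1645/10000 * w\<^sup>2"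
        using w mult_mono[OF w(2) w(2)] by (intro mult_mono; simp)+
      then show "w ^ 3 \<le> 4055/10000 * w\<^sup>2" "w ^ 5 \<le> 4055/10000 * w ^ 4" "w ^ 6 \<le> 1645/10000 * w ^ 4"
        "w ^ 4 \<le> 1645/10000 * w\<^sup>2"
        using w by (simp_all add: eval_nat_numeral mult.assoc)
    qed
    \<comment> \<open>The linear term is absorbed into the constant and the quadratic term by its tangent parabola at w = 1/5.\<close>
    have "(w - 1/5)\<^sup>2 \<ge> 0" by simp
    then have "342/1000000 * w \<le> 855/1000000 * w\<^sup>2 + 342/10000000" by (simp add: power2_eq_square algebra_simps)
    then show ?thesis using p w zero_le_power2[of w] by linarith
  qed
  finally show ?thesis .
qed

lemma kernel_\<alpha>_pos_second:
  assumes t: "ln 2 \<le> t" "t < ln 3"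
  shows "kernel \<alpha> \<beta> \<alpha> t > 0"
proof -
  define L w where "L = ln (2::real)" and "w = t - L"
  have w: "0 \<le> w" "w \<le> 4055/10000" and L: "L \<ge> 69/100" "L \<le> 7/10"
    using t ln_2_bounds ln_3_bounds by (auto simp: w_def L_def)
  have k: "kernel \<alpha> \<beta> \<alpha> t = t ^ 6 / 720 + \<beta> * (t ^ 5 / 120) - L * (w ^ 4 / 48 + \<beta> * w ^ 3 / 12 + \<alpha> * w\<^sup>2 / 4)"
    unfolding kernel_second_interval[OF t] L_def[symmetric] w_def[symmetric] by (simp add: algebra_simps)
  have t: "t \<ge> 69/100 + w" using L by (simp add: w_def)
  have "t ^ 5 \<ge> (69/100 + w) ^ 5" "t ^ 6 \<ge> (69/100 + w) ^ 6"
    using t w by (intro power_mono; simp)+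
  moreover have "(69/100 + w) ^ 5 \<ge> 15/100 + 113/100 * w + 328/100 * w\<^sup>2 + 47/10 * w ^ 3"
    "(69/100 + w) ^ 6 \<ge> 1/10 + 93/100 * w + 34/10 * w\<^sup>2 + 65/10 * w ^ 3 + 7 * w ^ 4"
  proof -
    have "(a + w) ^ 5 = a ^ 5 + 5 * a ^ 4 * w + 10 * a ^ 3 * w\<^sup>2 + 10 * a\<^sup>2 * w ^ 3 + 5 * a * w ^ 4 + w ^ 5"
      "(a + w) ^ 6 = a ^ 6 + 6 * a ^ 5 * w + 15 * a ^ 4 * w\<^sup>2 + 20 * a ^ 3 * w ^ 3 + 15 * a\<^sup>2 * w ^ 4
          + 6 * a * w ^ 5 + w ^ 6" for a
      by (simp_all add: eval_nat_numeral algebra_simps)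
    note e = this[of "69/100", simplified power_divide, simplified]
    have nn: "0 \<le> w ^ n" for n using w by simp
    show "(69/100 + w) ^ 5 \<ge> 15/100 + 113/100 * w + 328/100 * w\<^sup>2 + 47/10 * w ^ 3"
      "(69/100 + w) ^ 6 \<ge> 1/10 + 93/100 * w + 34/10 * w\<^sup>2 + 65/10 * w ^ 3 + 7 * w ^ 4"
      using e w(1) nn[of 2] nn[of 3] nn[of 4] nn[of 5] nn[of 6] by linarith+
  qed
  ultimately have t5: "t ^ 5 \<ge> 15/100 + 113/100 * w + 328/100 * w\<^sup>2 + 47/10 * w ^ 3"
    and t6: "t ^ 6 \<ge> 1/10 + 93/100 * w + 34/10 * w\<^sup>2 + 65/10 * w ^ 3 + 7 * w ^ 4"
    by linarith+
  have "\<beta> * (t ^ 5 / 120) \<ge> 133/1000 * ((15/100 + 113/100 * w + 328/100 * w\<^sup>2 + 47/10 * w ^ 3) / 120)"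
    using \<beta>_bounds t5 w by (intro mult_mono divide_right_mono) auto
  then have "399/20000 + 15029/100000 * w + 5453/12500 * w\<^sup>2 + 6251/10000 * w ^ 3 \<le> \<beta> * t ^ 5"
    by (simp add: add_divide_distrib)
  moreover have "L * (w ^ 4 / 48 + \<beta> * w ^ 3 / 12 + \<alpha> * w\<^sup>2 / 4)
      \<le> 7/10 * (w ^ 4 / 48 + 134/1000 * w ^ 3 / 12 + 73/1000 * w\<^sup>2 / 4)"
    using \<beta>_bounds \<alpha>_bounds w L by (intro mult_mono add_mono divide_right_mono mult_right_mono) auto
  then have "L * (w ^ 4 / 48 + \<beta> * w ^ 3 / 12 + \<alpha> * w\<^sup>2 / 4)
      \<le> 7/480 * w ^ 4 + 469/60000 * w ^ 3 + 511/40000 * w\<^sup>2"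
    by (simp add: add_divide_distrib)
  moreover have "w\<^sup>2 \<le> 4055/10000 * w" "w ^ 4 \<le> 4055/10000 * w ^ 3" "w ^ 3 \<ge> 0" "w\<^sup>2 \<ge> 0"
    using mult_right_mono[OF w(2), of w] mult_right_mono[OF w(2), of "w ^ 3"] w
    by (simp_all add: eval_nat_numeral mult.assoc)
  ultimately show ?thesis
    unfolding k using t6 w by linarith
qed

theorem kernel_\<delta>_neg: "t > 0 \<Longrightarrow> kernel \<alpha> \<beta> \<delta> t < 0"
  using kernel_\<delta>_neg_first kernel_\<delta>_neg_second kernel_\<delta>_neg_tail by (meson not_le)

theorem kernel_\<alpha>_pos: "t > 0 \<Longrightarrow> kernel \<alpha> \<beta> \<alpha> t > 0"
  using kernel_\<alpha>_pos_first kernel_\<alpha>_pos_second kernel_\<alpha>_pos_tail by (meson not_le)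

end

section \<open>Laplace transforms\<close>

lemma nn_integral_shifted_power_exp:
  fixes a h :: real
  assumes "h > 0"
  shows "(\<integral>\<^sup>+t. ennreal ((t - a) ^ p / fact p * exp (- h * t)) * indicator {a..} t \<partial>lborel)
       = ennreal (exp (- h * a) / h ^ Suc p)"
proof -
  let ?I = "\<integral>\<^sup>+t. ennreal ((t - a) ^ p / fact p * exp (- h * t)) * indicator {a..} t \<partial>lborel"
  have "ennreal (fact p) = (\<integral>\<^sup>+x. ennreal (x ^ p * exp (- x)) * indicator {0..} x \<partial>lborel)"
    by (subst nn_intergal_power_times_exp_Ici) simp
  also have "\<dots> = ennreal h * (\<integral>\<^sup>+t. ennreal ((h * (t - a)) ^ p * exp (- (h * (t - a)))) * indicator {0..}
      (h * (t - a)) \<partial>lborel)"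
    using assms by (subst nn_integral_real_affine[where c = h and t = "- h * a"]) (auto simp: algebra_simps)
  also have "(\<integral>\<^sup>+t. ennreal ((h * (t - a)) ^ p * exp (- (h * (t - a)))) * indicator {0..} (h * (t - a)) \<partial>lborel)
      = (\<integral>\<^sup>+t. ennreal (h ^ p * fact p * exp (h * a)) *
          (ennreal ((t - a) ^ p / fact p * exp (- h * t)) * indicator {a..} t) \<partial>lborel)"
  proof (intro nn_integral_cong)
    fix t
    have "exp (- (h * (t - a))) = exp (h * a) * exp (- h * t)"
      by (simp add: algebra_simps flip: exp_add)
    then have "(h * (t - a)) ^ p * exp (- (h * (t - a)))
        = h ^ p * fact p * exp (h * a) * ((t - a) ^ p / fact p * exp (- h * t))"
      by (simp add: power_mult_distrib)
    moreover have "0 \<le> h * (t - a) \<longleftrightarrow> a \<le> t" using assms by (simp add: zero_le_mult_iff)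
    ultimately show "ennreal ((h * (t - a)) ^ p * exp (- (h * (t - a)))) * indicator {0..} (h * (t - a))
       = ennreal (h ^ p * fact p * exp (h * a)) * (ennreal ((t - a) ^ p / fact p * exp (- h * t)) * indicator {a..} t)"
      using assms by (auto simp: indicator_def ennreal_mult[symmetric])
  qed
  also have "\<dots> = ennreal (h ^ p * fact p * exp (h * a)) * ?I"
    by (intro nn_integral_cmult) auto
  also have "ennreal h * (ennreal (h ^ p * fact p * exp (h * a)) * ?I) = ennreal (h ^ Suc p * fact p * exp (h * a)) * ?I"
    using assms by (simp add: mult.assoc[symmetric] ennreal_mult[symmetric] del: fact_Suc)
  finally have eq: "ennreal (h ^ Suc p * fact p * exp (h * a)) * ?I = ennreal (fact p)" ..
  have "ennreal (exp (- h * a) / h ^ Suc p)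
      = ennreal (1 / (h ^ Suc p * fact p * exp (h * a))) * ennreal (fact p)"
    using assms by (simp add: ennreal_mult[symmetric] exp_minus field_simps)
  also have "\<dots> = ennreal (1 / (h ^ Suc p * fact p * exp (h * a))) * ennreal (h ^ Suc p * fact p * exp (h * a)) * ?I"
    unfolding eq[symmetric] by (simp add: mult.assoc)
  also have "\<dots> = ?I"
    using assms by (subst ennreal_mult[symmetric]) auto
  finally show ?thesis ..
qed

lemma has_bochner_integral_shifted_power_exp:
  fixes a h :: real
  assumes "h > 0"
  shows "has_bochner_integral lborel (\<lambda>t. indicator {a..} t * ((t - a) ^ p / fact p * exp (- h * t)))
       (exp (- h * a) / h ^ Suc p)"
proof (rule has_bochner_integral_nn_integral)
  have "(\<integral>\<^sup>+t. ennreal (indicator {a..} t * ((t - a) ^ p / fact p * exp (- h * t))) \<partial>lborel)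
      = (\<integral>\<^sup>+t. ennreal ((t - a) ^ p / fact p * exp (- h * t)) * indicator {a..} t \<partial>lborel)"
    by (intro nn_integral_cong) (auto simp: indicator_def)
  then show "(\<integral>\<^sup>+t. ennreal (indicator {a..} t * ((t - a) ^ p / fact p * exp (- h * t))) \<partial>lborel)
      = ennreal (exp (- h * a) / h ^ Suc p)"
    using nn_integral_shifted_power_exp[OF assms] by simp
qed (use assms in \<open>auto simp: indicator_def\<close>)

text \<open>
  For each t only finitely many n contribute, and all contributions are nonnegative, so sum and
  integral may be exchanged.
\<close>

lemma laplace_counting_sum:
  fixes c :: "nat \<Rightarrow> real" and h :: real
  assumes h: "h > 0" and c: "\<And>n. c n \<ge> 0" and sm: "summable (\<lambda>n. c n * exp (- h * ln n))" and c0: "c 0 = 0"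
  shows "has_bochner_integral lborel
     (\<lambda>t. indicator {0..} t * ((\<Sum>n\<in>{0<..nat \<lfloor>exp t\<rfloor>}. c n * ((t - ln (real n)) ^ p / fact p)) * exp (- h * t)))
     ((\<Sum>n. c n * exp (- h * ln n)) / h ^ Suc p)"
proof -
  define g where "g n t = indicator {ln (real n)..} t * ((t - ln (real n)) ^ p / fact p * exp (- h * t))" for n t
  have g: "has_bochner_integral lborel (g n) (exp (- h * ln n) / h ^ Suc p)" for n
    unfolding g_def by (rule has_bochner_integral_shifted_power_exp[OF h])
  have g0: "g n t \<ge> 0" for n t by (auto simp: g_def indicator_def)
  have fin: "indicator {0..} t * ((\<Sum>n\<in>{0<..nat \<lfloor>exp t\<rfloor>}. c n * ((t - ln (real n)) ^ p / fact p)) * exp (- h * t))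
      = (\<Sum>n. c n * g n t)" and fin': "finite {n. c n * g n t \<noteq> 0}" for t
  proof -
    have iff: "n \<le> nat \<lfloor>exp t\<rfloor> \<longleftrightarrow> ln (real n) \<le> t" if "n > 0" for n
    proof -
      have "ln (real n) \<le> t \<longleftrightarrow> real n \<le> exp t"
        using that by (metis exp_le_cancel_iff exp_ln of_nat_0_less_iff)
      also have "\<dots> \<longleftrightarrow> n \<le> nat \<lfloor>exp t\<rfloor>" by (simp add: le_nat_floor le_nat_iff le_floor_iff)
      finally show ?thesis ..
    qed
    have zero: "c n * g n t = 0" if "n \<notin> {0<..nat \<lfloor>exp t\<rfloor>}" for n
      using that iff[of n] c0 by (cases "n = 0") (auto simp: g_def indicator_def)
    then have "{n. c n * g n t \<noteq> 0} \<subseteq> {0<..nat \<lfloor>exp t\<rfloor>}" by blast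
    then show "finite {n. c n * g n t \<noteq> 0}" by (rule finite_subset) simp
    have sum_eq: "(\<Sum>n. c n * g n t) = (\<Sum>n\<in>{0<..nat \<lfloor>exp t\<rfloor>}. c n * g n t)"
      by (rule suminf_finite) (use zero in auto)
    show "indicator {0..} t * ((\<Sum>n\<in>{0<..nat \<lfloor>exp t\<rfloor>}. c n * ((t - ln (real n)) ^ p / fact p)) * exp (- h * t))
      = (\<Sum>n. c n * g n t)"
    proof (cases "t \<ge> 0")
      case True
      then show ?thesis
        unfolding sum_eq sum_distrib_right sum_distrib_left
        by (intro sum.cong) (auto simp: g_def indicator_def iff)
    next
      case False
      then have "exp t < 1" by simp
      then have "nat \<lfloor>exp t\<rfloor> = 0" by simp
      then show ?thesis using False by (simp add: sum_eq)
    qed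
  qed
  have int: "integrable lborel (\<lambda>t. c n * g n t)" for n
    using g[of n] by (auto simp: has_bochner_integral_iff)
  have val: "(\<integral>t. c n * g n t \<partial>lborel) = c n * exp (- h * ln n) / h ^ Suc p" for n
    using g[of n] by (auto simp: has_bochner_integral_iff)
  have nrm: "norm (c n * g n t) = c n * g n t" for n t using c g0 by simp
  have sm': "summable (\<lambda>n. c n * exp (- h * ln n) / h ^ Suc p)" by (rule summable_divide[OF sm])
  have 1: "AE t in lborel. summable (\<lambda>n. norm (c n * g n t))"
    unfolding nrm by (rule AE_I2, rule summable_finite[OF fin']) blast
  have 2: "summable (\<lambda>n. \<integral>t. norm (c n * g n t) \<partial>lborel)"
    unfolding nrm val by (rule sm')
  have "integrable lborel (\<lambda>t. \<Sum>n. c n * g n t)"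
    by (rule integrable_suminf[OF int 1 2])
  moreover have "(\<integral>t. (\<Sum>n. c n * g n t) \<partial>lborel) = (\<Sum>n. c n * exp (- h * ln n)) / h ^ Suc p"
    using integral_suminf[OF int 1 2] suminf_divide[OF sm, of "h ^ Suc p"] unfolding val by simp
  ultimately show ?thesis
    unfolding fin by (simp add: has_bochner_integral_iff)
qed

text \<open>
  The Dirichlet series form of \<zeta>'(1 + h) + 1/h^2 for h > 0.
\<close>

definition dzeta_reg :: "real \<Rightarrow> real" where
  "dzeta_reg h = 1 / h\<^sup>2 - (\<Sum>n. ln (real n) / real n * exp (- h * ln (real n)))"

lemma laplace_defect:
  assumes h: "h > 0" and sm: "summable (\<lambda>n. ln (real n) / real n * exp (- h * ln (real n)))"
  shows "has_bochner_integral lborel (\<lambda>t. indicator {0..} t * (defect p t * exp (- h * t)))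
     (dzeta_reg h / h ^ Suc p)"
proof -
  have nonneg: "ln (real n) \<ge> 0" for n by (cases "n = 0") auto
  have "has_bochner_integral lborel
      (\<lambda>t. indicator {0..} t * ((t - 0) ^ (p + 2) / fact (p + 2) * exp (- h * t))
         - indicator {0..} t * ((\<Sum>n\<in>{0<..nat \<lfloor>exp t\<rfloor>}. ln (real n) / real n * ((t - ln (real n)) ^ p / fact p))
             * exp (- h * t)))
      (exp (- h * 0) / h ^ Suc (p + 2) - (\<Sum>n. ln (real n) / real n * exp (- h * ln n)) / h ^ Suc p)"
    by (intro has_bochner_integral_diff has_bochner_integral_shifted_power_exp laplace_counting_sum h sm)
       (auto intro!: divide_nonneg_nonneg simp: nonneg)
  also have "exp (- h * 0) / h ^ Suc (p + 2) - (\<Sum>n. ln (real n) / real n * exp (- h * ln n)) / h ^ Suc p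
     = dzeta_reg h / h ^ Suc p"
    using h by (simp add: dzeta_reg_def field_simps power2_eq_square)
  finally show ?thesis
    by (simp add: defect_def algebra_simps)
qed

text \<open>
  The Laplace transform of \<open>remainder 3\<close> is (F(h) - c_0 - c_1 h - c_2 h^2 - c_3 h^3) / h^4.  Since
  \<open>remainder 3\<close> is bounded by 1 on [0, \<infinity>), the transform is at most 1/h in absolute value.
\<close>

lemma taylor_dzeta_reg:
  assumes h: "h > 0" and sm: "summable (\<lambda>n. ln (real n) / real n * exp (- h * ln (real n)))"
  shows "\<bar>dzeta_reg h - (taylor_coeff 0 + taylor_coeff 1 * h + taylor_coeff 2 * h\<^sup>2 + taylor_coeff 3 * h ^ 3)\<bar> \<le> h ^ 3"
proof -
  let ?P = "taylor_coeff 0 + taylor_coeff 1 * h + taylor_coeff 2 * h\<^sup>2 + taylor_coeff 3 * h ^ 3"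
  have poly: "has_bochner_integral lborel (\<lambda>t. indicator {0..} t * (t ^ p / fact p * exp (- h * t)))
      (1 / h ^ Suc p)" for p
    using has_bochner_integral_shifted_power_exp[OF h, of 0 p] by simp
  have "has_bochner_integral lborel
     (\<lambda>t. indicator {0..} t * (defect 3 t * exp (- h * t))
        - (\<Sum>j\<le>3. taylor_coeff j * (indicator {0..} t * (t ^ (3 - j) / fact (3 - j) * exp (- h * t)))))
     (dzeta_reg h / h ^ Suc 3 - (\<Sum>j\<le>3. taylor_coeff j * (1 / h ^ Suc (3 - j))))"
    by (intro has_bochner_integral_diff has_bochner_integral_sum has_bochner_integral_mult_right laplace_defect h sm poly)
  also have "(\<lambda>t. indicator {0..} t * (defect 3 t * exp (- h * t))
        - (\<Sum>j\<le>3. taylor_coeff j * (indicator {0..} t * (t ^ (3 - j) / fact (3 - j) * exp (- h * t)))))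
     = (\<lambda>t. indicator {0..} t * (remainder 3 t * exp (- h * t)))"
    by (simp add: fun_eq_iff remainder_def algebra_simps sum_distrib_left)
  also have "dzeta_reg h / h ^ Suc 3 - (\<Sum>j\<le>3. taylor_coeff j * (1 / h ^ Suc (3 - j))) = (dzeta_reg h - ?P) / h ^ 4"
    using h by (simp add: atMost_nat_numeral field_simps eval_nat_numeral)
  finally have R: "has_bochner_integral lborel (\<lambda>t. indicator {0..} t * (remainder 3 t * exp (- h * t)))
      ((dzeta_reg h - ?P) / h ^ 4)" .
  have bound: "\<bar>remainder 3 t\<bar> \<le> 1" if t: "t \<ge> 0" for t
  proof -
    have e: "exp t \<ge> 1 + t" "exp t \<ge> 1" using t by auto
    have "t / exp t ^ 4 \<le> 1"
    proof -
      have "t \<le> exp t ^ 1" using e(1) unfolding power_one_right by linarith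
      also have "\<dots> \<le> exp t ^ 4" using e by (intro power_increasing) auto
      finally show ?thesis by (simp add: divide_le_eq)
    qed
    moreover have "(40 * t + 40) / exp t ^ 5 \<le> 40"
    proof -
      have "(40 * t + 40) \<le> 40 * exp t ^ 1" using e(1) unfolding power_one_right by linarith
      also have "\<dots> \<le> 40 * exp t ^ 5" using e by (intro mult_left_mono power_increasing) auto
      finally show ?thesis by (simp add: divide_le_eq)
    qed
    ultimately have "t / exp t ^ 4 / 720 \<le> 1 / 720" "(40 * t + 40) / exp t ^ 5 / 4200 \<le> 40 / 4200"
      by (intro divide_right_mono; simp)+
    then show ?thesis using remainder_3_bound[OF t] by linarith
  qed
  have "\<bar>(dzeta_reg h - ?P) / h ^ 4\<bar> = \<bar>\<integral>t. indicator {0..} t * (remainder 3 t * exp (- h * t)) \<partial>lborel\<bar>"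
    using R by (simp add: has_bochner_integral_iff)
  also have "\<dots> \<le> (\<integral>t. \<bar>indicator {0..} t * (remainder 3 t * exp (- h * t))\<bar> \<partial>lborel)"
    by (rule integral_abs_bound)
  also have "\<dots> \<le> (\<integral>t. indicator {0..} t * (t ^ 0 / fact 0 * exp (- h * t)) \<partial>lborel)"
  proof (rule integral_mono)
    show "integrable lborel (\<lambda>t. \<bar>indicator {0..} t * (remainder 3 t * exp (- h * t))\<bar>)"
      using R by (simp add: has_bochner_integral_iff)
    show "integrable lborel (\<lambda>t. indicator {0..} t * (t ^ 0 / fact 0 * exp (- h * t)))"
      using poly[of 0] by (simp add: has_bochner_integral_iff)
    show "\<bar>indicator {0..} t * (remainder 3 t * exp (- h * t))\<bar>
        \<le> indicator {0..} t * (t ^ 0 / fact 0 * exp (- h * t))" for t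
      using bound[of t] by (auto simp: indicator_def abs_mult)
  qed
  also have "\<dots> = 1 / h" using poly[of 0] by (simp add: has_bochner_integral_iff)
  finally show ?thesis
    using h by (simp add: abs_divide divide_le_eq eval_nat_numeral mult_ac)
qed

lemma integral_pos_lborel:
  fixes f :: "real \<Rightarrow> real" and x :: real
  assumes f: "has_bochner_integral lborel (\<lambda>t. indicator {0..} t * f t) x" and pos: "\<And>t. t > 0 \<Longrightarrow> f t > 0"
  shows "x > 0"
proof -
  have int: "integrable lborel (\<lambda>t. indicator {0..} t * f t)" and x: "(\<integral>t. indicator {0..} t * f t \<partial>lborel) = x"
    using f by (auto simp: has_bochner_integral_iff)
  have nn: "AE t in lborel. 0 \<le> indicator {0..} t * f t"
    by (rule AE_mp[OF AE_lborel_singleton[of "0::real"]], rule AE_I2) (use pos in \<open>auto simp: indicator_def less_imp_le\<close>)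
  have "x \<ge> 0" using integral_nonneg_AE[OF nn] x by simp
  moreover have "x \<noteq> 0"
  proof
    assume "x = 0"
    then have "AE t in lborel. indicator {0..} t * f t = 0"
      using integral_nonneg_eq_0_iff_AE[OF int nn] x by simp
    then have "AE t in lborel. t \<notin> {0<..<1::real}"
      by eventually_elim (use pos in \<open>auto simp: indicator_def, fastforce\<close>)
    then have "emeasure lborel {t \<in> space lborel. \<not> t \<notin> {0<..<1::real}} = 0"
      by (subst (asm) AE_iff_measurable[OF _ refl]) auto
    also have "{t \<in> space lborel. \<not> t \<notin> {0<..<1::real}} = {0<..<1}" by auto
    finally have "ennreal (1 - 0) = 0"
      unfolding emeasure_lborel_Ioo[OF zero_le_one] .
    then show False by simp
  qed
  ultimately show ?thesis by simp
qed

lemma laplace_kernel: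
  assumes h: "h > 0" and sm: "summable (\<lambda>n. ln (real n) / real n * exp (- h * ln (real n)))"
  shows "has_bochner_integral lborel (\<lambda>t. indicator {0..} t * (kernel \<alpha> \<beta> c t * exp (- h * t)))
     ((dzeta_reg h * (1 + \<beta> * h + c * h\<^sup>2) - \<alpha>) / h ^ 5)"
proof -
  have poly: "has_bochner_integral lborel (\<lambda>t. indicator {0..} t * (t ^ 4 / fact 4 * exp (- h * t))) (1 / h ^ Suc 4)"
    using has_bochner_integral_shifted_power_exp[OF h, of 0 4] by simp
  have "has_bochner_integral lborel (\<lambda>t. indicator {0..} t * (defect 4 t * exp (- h * t))
       + \<beta> * (indicator {0..} t * (defect 3 t * exp (- h * t))) + c * (indicator {0..} t * (defect 2 t * exp (- h * t)))
       - \<alpha> * (indicator {0..} t * (t ^ 4 / fact 4 * exp (- h * t))))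
     (dzeta_reg h / h ^ Suc 4 + \<beta> * (dzeta_reg h / h ^ Suc 3) + c * (dzeta_reg h / h ^ Suc 2) - \<alpha> * (1 / h ^ Suc 4))"
    by (intro has_bochner_integral_diff has_bochner_integral_add has_bochner_integral_mult_right laplace_defect h sm poly)
  moreover have "dzeta_reg h / h ^ Suc 4 + \<beta> * (dzeta_reg h / h ^ Suc 3) + c * (dzeta_reg h / h ^ Suc 2) - \<alpha> *
      (1 / h ^ Suc 4)
      = (dzeta_reg h * (1 + \<beta> * h + c * h\<^sup>2) - \<alpha>) / h ^ 5"
    using h by (simp add: field_simps eval_nat_numeral)
  moreover have "(\<lambda>t. indicator {0..} t * (defect 4 t * exp (- h * t))
       + \<beta> * (indicator {0..} t * (defect 3 t * exp (- h * t))) + c * (indicator {0..} t * (defect 2 t * exp (- h * t)))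
       - \<alpha> * (indicator {0..} t * (t ^ 4 / fact 4 * exp (- h * t))))
      = (\<lambda>t. indicator {0..} t * (kernel \<alpha> \<beta> c t * exp (- h * t)))"
    by (simp add: kernel_def fun_eq_iff fact_numeral algebra_simps)
  ultimately show ?thesis by simp
qed

context stieltjes_params begin

lemma dzeta_reg_bounds:
  assumes h: "h > 0" and sm: "summable (\<lambda>n. ln (real n) / real n * exp (- h * ln (real n)))"
  shows "\<alpha> / (1 + \<beta> * h + \<alpha> * h\<^sup>2) < dzeta_reg h" and "dzeta_reg h < \<alpha> / (1 + \<beta> * h + \<delta> * h\<^sup>2)"
proof -
  have "0 < (dzeta_reg h * (1 + \<beta> * h + \<alpha> * h\<^sup>2) - \<alpha>) / h ^ 5"
    by (rule integral_pos_lborel[OF laplace_kernel[OF h sm]]) (use kernel_\<alpha>_pos in auto)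
  moreover have "1 + \<beta> * h + \<alpha> * h\<^sup>2 > 0"
    using h \<beta>_bounds \<alpha>_bounds by (intro add_pos_pos mult_pos_pos) auto
  ultimately show "\<alpha> / (1 + \<beta> * h + \<alpha> * h\<^sup>2) < dzeta_reg h"
    using h by (simp add: zero_less_divide_iff divide_less_eq)
  have "0 < - ((dzeta_reg h * (1 + \<beta> * h + \<delta> * h\<^sup>2) - \<alpha>) / h ^ 5)"
  proof (rule integral_pos_lborel)
    show "has_bochner_integral lborel (\<lambda>t. indicator {0..} t * (- (kernel \<alpha> \<beta> \<delta> t * exp (- h * t))))
        (- ((dzeta_reg h * (1 + \<beta> * h + \<delta> * h\<^sup>2) - \<alpha>) / h ^ 5))"
      using has_bochner_integral_minus[OF laplace_kernel[OF h sm]] by simp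
  qed (use kernel_\<delta>_neg in \<open>auto simp: mult_less_0_iff\<close>)
  moreover have "1 + \<beta> * h + \<delta> * h\<^sup>2 > 0"
    using h \<beta>_bounds \<delta>_bounds by (intro add_pos_pos mult_pos_pos) auto
  ultimately show "dzeta_reg h < \<alpha> / (1 + \<beta> * h + \<delta> * h\<^sup>2)"
    using h by (simp add: divide_less_0_iff less_divide_eq)
qed

end

section \<open>Analytic continuation of zeta\<close>

text \<open>
  On a ball around s that stays within Re > (Re s + 1) / 2 the series is dominated by a convergent one;
  hence it may be differentiated term by term.
\<close>

lemma dirichlet_series_deriv:
  obtains Z Z' where
    "\<And>s. Re s > 1 \<Longrightarrow> (\<lambda>n. of_nat (Suc n) powr (- s)) sums (Z s :: complex)"
    "\<And>s. Re s > 1 \<Longrightarrow> (\<lambda>n. - of_real (ln (Suc n)) * of_nat (Suc n) powr (- s)) sums (Z' s)"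
    "\<And>s. Re s > 1 \<Longrightarrow> (Z has_field_derivative Z' s) (at s)"
proof -
  have "\<exists>g g'. \<forall>s\<in>{s. Re s > 1}. (\<lambda>n. of_nat (Suc n) powr (- s)) sums (g s :: complex) \<and>
      (\<lambda>n. - of_real (ln (Suc n)) * of_nat (Suc n) powr (- s)) sums g' s \<and> (g has_field_derivative g' s) (at s)"
  proof (rule series_and_derivative_comparison_local)
    show "open {s. 1 < Re s}" by (rule open_halfspace_Re_gt)
  next
    fix n and s :: complex
    show "((\<lambda>s. of_nat (Suc n) powr (- s)) has_field_derivative - of_real (ln (Suc n)) * of_nat (Suc n) powr
        (- s)) (at s)"
    proof -
      have "((\<lambda>s. of_nat (Suc n) powr (- s) :: complex) has_field_derivative
          (Ln (of_nat (Suc n)) * of_nat (Suc n) powr (- s)) * (- 1)) (at s)"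
        by (rule DERIV_chain2[OF has_field_derivative_powr_right])
            (auto intro!: derivative_eq_intros simp del: of_nat_Suc)
      then show ?thesis by (simp add: Ln_of_nat del: of_nat_Suc)
    qed
  next
    fix s :: complex assume s: "s \<in> {s. 1 < Re s}"
    define d where "d = (Re s - 1) / 2"
    define \<sigma> where "\<sigma> = (Re s + 1) / 2"
    have d: "d > 0" "\<sigma> > 1" using s by (auto simp: d_def \<sigma>_def)
    have "summable (\<lambda>n. real (Suc n) powr (- \<sigma>))"
      using d summable_real_powr_iff[of "- \<sigma>"] by (subst summable_Suc_iff) auto
    moreover have "norm (of_nat (Suc n) powr (- y) :: complex) \<le> real (Suc n) powr (- \<sigma>)"
      if "y \<in> ball s d" for n y
    proof -
      have "\<bar>Re (s - y)\<bar> \<le> norm (s - y)" by (rule abs_Re_le_cmod)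
      also have "\<dots> < d" using that by (simp add: dist_norm)
      finally have "Re s - Re y < d" by simp
      then have "- Re y \<le> - \<sigma>" by (simp add: d_def \<sigma>_def field_simps)
      moreover have "norm (of_nat (Suc n) powr (- y) :: complex) = real (Suc n) powr (- Re y)"
        by (subst norm_powr_real_powr) auto
      ultimately show ?thesis by (simp add: powr_mono)
    qed
    ultimately show "\<exists>d h. 0 < d \<and> summable h \<and>
       (\<forall>\<^sub>F n in sequentially. \<forall>y\<in>ball s d \<inter> {s. 1 < Re s}. norm (of_nat (Suc n) powr (- y) :: complex) \<le> h n)"
      using d by (intro exI[of _ d] exI[of _ "\<lambda>n. real (Suc n) powr (- \<sigma>)"]) auto
  qed
  then show ?thesis using that by blast
qed

text \<open>
  This is (s - 1) (\<zeta>(s) - 1).  The factor s - 1 removes the pole, and leaving out the term 1 of the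
  series gives the decay 2^(- Re s), on which the convergence of the recursion below rests.
\<close>

definition zeta_numerator :: "complex \<Rightarrow> complex" where
  "zeta_numerator s = (s - 1) * (\<Sum>n. of_nat (n + 2) powr (- s))"

lemma norm_of_nat_powr: "norm (of_nat n powr s :: complex) = real n powr Re s"
  by (subst norm_powr_real_powr) auto

lemma summable_powr_shift2: "\<sigma> > 1 \<Longrightarrow> summable (\<lambda>n. real (n + 2) powr (- \<sigma>))"
  using summable_real_powr_iff[of "- \<sigma>"] by (subst summable_iff_shift) auto

lemma summable_complex_powr_shift2: "Re s > 1 \<Longrightarrow> summable (\<lambda>n. of_nat (n + 2) powr (- s) :: complex)"
  by (rule summable_norm_cancel) (use summable_powr_shift2[of "Re s"] in \<open>simp only: norm_of_nat_powr uminus_complex.sel\<close>)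

lemma zeta_numerator_holomorphic: "zeta_numerator holomorphic_on {s. Re s > 1}"
proof -
  obtain Z Z' where Z: "\<And>s. Re s > 1 \<Longrightarrow> (\<lambda>n. of_nat (Suc n) powr (- s)) sums (Z s :: complex)"
    "\<And>s. Re s > 1 \<Longrightarrow> (Z has_field_derivative Z' s) (at s)" by (rule dirichlet_series_deriv) auto
  have "(\<lambda>n. of_nat (n + 2) powr (- s)) sums (Z s - 1)" if "Re s > 1" for s
    using sums_split_initial_segment[OF Z(1)[OF that], of 1] by simp
  then have "zeta_numerator s = (s - 1) * (Z s - 1)" if "Re s > 1" for s
    unfolding zeta_numerator_def using that sums_unique by metis
  moreover have "(\<lambda>s. (s - 1) * (Z s - 1)) holomorphic_on {s. Re s > 1}"
    using Z(2) by (intro holomorphic_intros) (auto simp: holomorphic_on_open open_halfspace_Re_gt)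
  ultimately show ?thesis
    by (subst holomorphic_cong[OF refl]) auto
qed

lemma zeta_numerator_bound:
  obtains C where "C \<ge> 0" "\<And>s. Re s \<ge> 2 \<Longrightarrow> norm (zeta_numerator s) \<le> norm (s - 1) * (C * 2 powr (- Re s))"
proof
  let ?C = "4 * (\<Sum>n. real (n + 2) powr (- 2))"
  have sm: "summable (\<lambda>n. real (n + 2) powr (- 2))" by (rule summable_powr_shift2) simp
  show "?C \<ge> 0" using sm by (intro mult_nonneg_nonneg suminf_nonneg) auto
  show "norm (zeta_numerator s) \<le> norm (s - 1) * (?C * 2 powr (- Re s))" if "Re s \<ge> 2" for s
  proof -
    have le: "real (n + 2) powr (- Re s) \<le> 4 * real (n + 2) powr (- 2) * 2 powr (- Re s)" for n
    proof -
      have "(real (n + 2) / 2) powr (- Re s) \<le> (real (n + 2) / 2) powr (- 2)"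
        using that by (intro powr_mono) auto
      then show ?thesis
        by (simp add: powr_divide powr_minus field_simps)
    qed
    have "norm (\<Sum>n. of_nat (n + 2) powr (- s) :: complex) \<le> (\<Sum>n. 4 * real (n + 2) powr (- 2) * 2 powr (- Re s))"
    proof (rule norm_suminf_le)
      show "norm (of_nat (n + 2) powr (- s) :: complex) \<le> 4 * real (n + 2) powr (- 2) * 2 powr (- Re s)" for n
        using le[of n] by (simp only: norm_of_nat_powr uminus_complex.sel)
      show "summable (\<lambda>n. 4 * real (n + 2) powr (- 2) * 2 powr (- Re s))"
        by (intro summable_mult summable_mult2 sm)
    qed
    also have "\<dots> = ?C * 2 powr (- Re s)"
      by (simp only: suminf_mult[OF summable_mult2[OF sm]] suminf_mult2[OF summable_mult[OF sm], symmetric]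
          suminf_mult[OF sm])
    finally show ?thesis unfolding zeta_numerator_def norm_mult by (intro mult_left_mono) auto
  qed
qed

lemma pochhammer_norm_le: "norm (pochhammer (z::complex) k) \<le> pochhammer (norm z) k"
proof (induction k)
  case (Suc k)
  have "norm (z + of_nat k) \<le> norm z + real k" using norm_triangle_ineq[of z "of_nat k"] by simp
  with Suc show ?case by (auto simp: pochhammer_Suc norm_mult intro!: mult_mono intro: order.trans[OF norm_ge_zero])
qed auto

lemma binomial_series_pochhammer:
  fixes a z :: complex assumes "norm z < 1"
  shows "(\<lambda>k. pochhammer a k / fact k * z ^ k) sums (1 - z) powr (- a)"
  using gen_binomial_complex[of "- z" "- a"] assms
  by (simp add: gbinomial_pochhammer power_minus[of z] mult_ac)

lemma summable_pochhammer_half: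
  fixes R :: real
  shows "summable (\<lambda>k. pochhammer R k / fact k * (1/2) ^ k)"
proof -
  have "(\<lambda>n. (- R gchoose n) * (- 1/2) ^ n) sums (1 + - 1/2) powr (- R)"
    by (rule gen_binomial_real) simp
  also have "(\<lambda>n. (- R gchoose n) * (- 1/2) ^ n) = (\<lambda>k. pochhammer R k / fact k * (1/2) ^ k)"
  proof
    fix n
    have "(- 1) ^ n * (- 1/2) ^ n = (1/2 :: real) ^ n" by (simp flip: power_mult_distrib)
    then show "(- R gchoose n) * (- 1/2) ^ n = pochhammer R n / fact n * (1/2) ^ n"
      by (simp add: gbinomial_pochhammer mult_ac)
  qed
  finally show ?thesis by (rule sums_summable)
qed

text \<open>
  The coefficients of the recursion \<Sum>_j (s-1)_j / (j+1)! E(s + j) = 1 for E(s) = (s - 1) (\<zeta>(s) - 1).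
\<close>

definition landau_coeff :: "complex \<Rightarrow> nat \<Rightarrow> complex" where
  "landau_coeff s j = pochhammer (s - 1) j / fact (Suc j)"

text \<open>
  Expand (n+1)^(1-s) = (n+2)^(1-s) (1 - 1/(n+2))^(1-s) by the binomial series, move its leading term
  (n+2)^(1-s) to the left, and sum over n < N: the left-hand side telescopes.
\<close>

lemma partial_landau:
  fixes s :: complex
  shows "(\<lambda>j. landau_coeff s j * ((s + of_nat j - 1) * (\<Sum>n<N. of_nat (n + 2) powr (- (s + of_nat j)))))
     sums (1 - of_nat (Suc N) powr (1 - s))"
proof -
  have one: "(\<lambda>j. landau_coeff s j * ((s + of_nat j - 1) * of_nat (n + 2) powr (- (s + of_nat j))))
     sums (of_nat (Suc n) powr (1 - s) - of_nat (n + 2) powr (1 - s))" for n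
  proof -
    define m :: complex where "m = of_nat (n + 2)"
    have m: "m \<noteq> 0" "norm m = real (n + 2)"
      unfolding m_def norm_of_nat of_nat_eq_0_iff by simp_all
    have nz: "norm (1 / m) < 1" unfolding norm_divide m by simp
    have 1: "(\<lambda>k. pochhammer (s - 1) k / fact k * (1 / m) ^ k * m powr (1 - s)) sums
        ((1 - 1 / m) powr (1 - s) * m powr (1 - s))"
      using sums_mult2[OF binomial_series_pochhammer[OF nz, of "s - 1"], of "m powr (1 - s)"] by simp
    have "(1 - 1 / m) powr (1 - s) * m powr (1 - s) = of_nat (Suc n) powr (1 - s)"
    proof -
      have "1 - 1 / m = of_real ((real n + 1) / (real n + 2))"
        using m by (simp add: m_def field_simps)
      moreover have "m = of_real (real n + 2)" by (simp add: m_def)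
      moreover have "complex_of_real ((real n + 1) / (real n + 2)) powr (1 - s) * of_real (real n + 2) powr (1 - s)
          = (of_real ((real n + 1) / (real n + 2)) * of_real (real n + 2)) powr (1 - s)"
        by (rule powr_times_real[symmetric]) auto
      moreover have "complex_of_nat n + 2 \<noteq> 0" using m(1) by (simp add: m_def add.commute)
      ultimately show ?thesis by (simp add: add.commute flip: of_real_mult)
    qed
    with 1 have "(\<lambda>k. pochhammer (s - 1) k / fact k * (1 / m) ^ k * m powr (1 - s)) sums of_nat (Suc n) powr (1 - s)"
      by simp
    from sums_split_initial_segment[OF this, of 1]
    have "(\<lambda>j. pochhammer (s - 1) (Suc j) / fact (Suc j) * (1 / m) ^ Suc j * m powr (1 - s))
        sums (of_nat (Suc n) powr (1 - s) - m powr (1 - s))" by simp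
    moreover have "pochhammer (s - 1) (Suc j) / fact (Suc j) * (1 / m) ^ Suc j * m powr (1 - s)
        = landau_coeff s j * ((s + of_nat j - 1) * m powr (- (s + of_nat j)))" for j
    proof -
      have "m powr (1 - s) = m powr (- (s + of_nat j)) * m powr (of_nat (Suc j))"
        by (simp add: algebra_simps flip: powr_add)
      also have "m powr (of_nat (Suc j)) = m ^ Suc j" using m by (rule_tac powr_nat') auto
      finally have "(1 / m) ^ Suc j * m powr (1 - s) = m powr (- (s + of_nat j))"
        using m by (simp add: power_divide del: power_Suc)
      then show ?thesis
        by (simp add: landau_coeff_def pochhammer_Suc mult.assoc algebra_simps add_divide_distrib
            diff_divide_distrib del: fact_Suc power_Suc)
    qed
    ultimately show ?thesis unfolding m_def by simp
  qed
  have "(\<lambda>j. \<Sum>n<N. landau_coeff s j * ((s + of_nat j - 1) * of_nat (n + 2) powr (- (s + of_nat j))))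
     sums (\<Sum>n<N. of_nat (Suc n) powr (1 - s) - of_nat (n + 2) powr (1 - s))"
    by (intro sums_sum one)
  also have "(\<Sum>n<N. of_nat (Suc n) powr (1 - s) - of_nat (n + 2) powr (1 - s)) = 1 - of_nat (Suc N) powr (1 - s)"
    using sum_lessThan_telescope'[of "\<lambda>n. of_nat (Suc n) powr (1 - s)" N] by simp
  finally show ?thesis by (simp add: sum_distrib_left)
qed

lemma norm_landau_coeff_le:
  assumes "norm (s - 1) \<le> R"
  shows "norm (landau_coeff s j * (s + of_nat j - 1)) \<le> pochhammer R (Suc j) / fact (Suc j)"
proof -
  have "landau_coeff s j * (s + of_nat j - 1) = pochhammer (s - 1) (Suc j) / fact (Suc j)"
    by (simp add: landau_coeff_def pochhammer_Suc algebra_simps del: fact_Suc)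
  moreover have "pochhammer (norm (s - 1)) (Suc j) \<le> pochhammer R (Suc j)"
    unfolding pochhammer_prod using assms by (intro prod_mono) auto
  ultimately show ?thesis
    using pochhammer_norm_le[of "s - 1" "Suc j"]
    by (simp add: norm_divide divide_right_mono del: fact_Suc)
qed

lemma summable_pochhammer_half_Suc:
  "summable (\<lambda>j. pochhammer R (Suc j) / fact (Suc j) * (1/2) ^ j)" for R :: real
proof -
  have "summable (\<lambda>j. 2 * (pochhammer R (Suc j) / fact (Suc j) * (1/2) ^ Suc j))"
    using summable_Suc_iff[THEN iffD2, OF summable_pochhammer_half[of R]] by (rule summable_mult)
  then show ?thesis by (simp del: fact_Suc)
qed

text \<open>
  Let N tend to infinity in the previous lemma.  Since n + 2 \<ge> 2, the j-th term carries a factor 2^(-j)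
  uniformly in N, which beats the growth of the coefficients and justifies the exchange of limits.
\<close>

lemma landau_identity:
  assumes s: "Re s > 1"
  shows "(\<lambda>j. landau_coeff s j * zeta_numerator (s + of_nat j)) sums 1"
proof -
  define a where "a j N = landau_coeff s j * ((s + of_nat j - 1) * (\<Sum>n<N. of_nat (n + 2) powr (- (s + of_nat j))))"
    for j N
  define S where "S = (\<Sum>n. real (n + 2) powr (- Re s))"
  define M where "M j = pochhammer (norm (s - 1)) (Suc j) / fact (Suc j) * (1/2) ^ j * S" for j
  have sm: "summable (\<lambda>n. real (n + 2) powr (- Re s))" by (rule summable_powr_shift2[OF s])
  have lim: "(a j \<longlongrightarrow> landau_coeff s j * zeta_numerator (s + of_nat j)) sequentially" for j
  proof -
    have "(\<lambda>N. \<Sum>n<N. of_nat (n + 2) powr (- (s + of_nat j)) :: complex)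
        \<longlonglongrightarrow> (\<Sum>n. of_nat (n + 2) powr (- (s + of_nat j)))"
      using s by (intro summable_LIMSEQ summable_complex_powr_shift2) simp
    then show ?thesis unfolding a_def zeta_numerator_def by (intro tendsto_intros)
  qed
  have bound: "norm (a j N) \<le> M j" for j N
  proof -
    have "norm (\<Sum>n<N. of_nat (n + 2) powr (- (s + of_nat j)) :: complex) \<le> (\<Sum>n<N. (1/2) ^ j * real (n + 2) powr (- Re s))"
    proof (rule sum_norm_le)
      fix n
      have "real (n + 2) powr (- real j) \<le> 2 powr (- real j)"
        by (intro powr_mono2') auto
      also have "\<dots> = (1/2) ^ j" by (simp add: powr_minus powr_realpow power_one_over inverse_eq_divide)
      finally have "real (n + 2) powr (- real j) * real (n + 2) powr (- Re s) \<le> (1/2) ^ j * real (n + 2) powr (- Re s)"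
        by (intro mult_right_mono) auto
      then show "norm (of_nat (n + 2) powr (- (s + of_nat j)) :: complex) \<le> (1/2) ^ j * real (n + 2) powr (- Re s)"
        unfolding norm_of_nat_powr by (simp add: add.commute flip: powr_add)
    qed
    also have "\<dots> = (1/2) ^ j * (\<Sum>n<N. real (n + 2) powr (- Re s))" by (simp add: sum_distrib_left)
    also have "\<dots> \<le> (1/2) ^ j * S"
      unfolding S_def by (intro mult_left_mono sum_le_suminf sm) auto
    finally have "norm (landau_coeff s j * (s + of_nat j - 1)) * norm
        (\<Sum>n<N. of_nat (n + 2) powr (- (s + of_nat j)) :: complex)
       \<le> pochhammer (norm (s - 1)) (Suc j) / fact (Suc j) * ((1/2) ^ j * S)"
      using order.trans[OF norm_ge_zero norm_landau_coeff_le[OF order.refl, of s j]]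
      by (intro mult_mono norm_landau_coeff_le) auto
    then show ?thesis by (simp add: a_def M_def norm_mult mult_ac del: fact_Suc)
  qed
  have "summable M"
    unfolding M_def by (intro summable_mult2 summable_pochhammer_half_Suc)
  then have "summable (\<lambda>j. norm (landau_coeff s j * zeta_numerator (s + of_nat j)))"
    and "((\<lambda>N. \<Sum>j. a j N) \<longlongrightarrow> (\<Sum>j. landau_coeff s j * zeta_numerator (s + of_nat j))) sequentially"
    using tannerys_theorem[of a "\<lambda>j. landau_coeff s j * zeta_numerator (s + of_nat j)" sequentially M, OF lim] bound
    by (auto simp: always_eventually)
  moreover have "(\<Sum>j. a j N) = 1 - of_nat (Suc N) powr (1 - s)" for N
    using partial_landau[of s N] unfolding a_def by (rule sums_unique[symmetric])
  moreover have "(\<lambda>N. 1 - of_nat (Suc N) powr (1 - s) :: complex) \<longlonglongrightarrow> 1 - 0"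
  proof (intro tendsto_intros)
    have "(\<lambda>N. real (Suc N) powr (Re (1 - s))) \<longlonglongrightarrow> 0"
      using s by (intro tendsto_neg_powr filterlim_compose[OF filterlim_real_sequentially filterlim_Suc]) auto
    then show "(\<lambda>N. of_nat (Suc N) powr (1 - s) :: complex) \<longlonglongrightarrow> 0"
      by (subst tendsto_norm_zero_iff[symmetric]) (simp only: norm_of_nat_powr)
  qed
  ultimately have "(\<Sum>j. landau_coeff s j * zeta_numerator (s + of_nat j)) = 1" and
    "summable (\<lambda>j. landau_coeff s j * zeta_numerator (s + of_nat j))"
    using LIMSEQ_unique by (force intro: summable_norm_cancel)+
  then show ?thesis by (simp add: sums_iff)
qed

text \<open>
  The term j = 0 of the recursion is the function itself, and all others involve arguments further to
  the right.  Solving for it extends the function to the left by one unit.  At s = 1 every other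
  coefficient contains the factor s - 1 and vanishes, which gives the value 1.
\<close>

lemma landau_step:
  assumes hol: "g holomorphic_on {s. Re s > 1 - real m}" and ext: "\<And>s. Re s > 1 \<Longrightarrow> g s = zeta_numerator s"
  obtains g' where "g' holomorphic_on {s. Re s > - real m}" "\<And>s. Re s > 1 \<Longrightarrow> g' s = zeta_numerator s" "g' 1 = 1"
proof -
  let ?A = "{s. Re s > - real m}"
  define T where "T j s = landau_coeff s (Suc j) * g (s + of_nat (Suc j))" for j s
  have open_A: "open ?A" by (rule open_halfspace_Re_gt)
  have T_hol: "T j holomorphic_on ?A" for j
  proof -
    have "(\<lambda>s. g (s + of_nat (Suc j))) holomorphic_on ?A"
      by (rule holomorphic_on_compose_gen[OF _ hol, unfolded o_def]) (auto intro!: holomorphic_intros)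
    moreover have "(\<lambda>s. landau_coeff s (Suc j)) holomorphic_on ?A"
      unfolding landau_coeff_def pochhammer_prod by (intro holomorphic_intros) auto
    ultimately show ?thesis unfolding T_def by (intro holomorphic_intros)
  qed
  obtain C where C: "C \<ge> 0" "\<And>s. Re s \<ge> 2 \<Longrightarrow> norm (zeta_numerator s) \<le> norm (s - 1) * (C * 2 powr (- Re s))"
    using zeta_numerator_bound by blast
  have "\<exists>G G'. \<forall>s\<in>?A. (\<lambda>j. T j s) sums G s \<and> (\<lambda>j. deriv (T j) s) sums G' s \<and> (G has_field_derivative G' s) (at s)"
  proof (rule series_and_derivative_comparison_local[OF open_A])
    show "(T j has_field_derivative deriv (T j) s) (at s)" if "s \<in> ?A" for j s
      using T_hol open_A that by (rule holomorphic_derivI)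
  next
    fix s0 assume s0: "s0 \<in> ?A"
    define R where "R = norm (s0 - 1) + 1"
    define h where "h j = pochhammer R (Suc (Suc j)) / fact (Suc (Suc j)) * (1/2) ^ Suc j * (C * 2 powr real m)" for j
    have "summable h" unfolding h_def
      by (intro summable_mult2 summable_Suc_iff[THEN iffD2, OF summable_pochhammer_half_Suc])
    moreover have "\<forall>\<^sub>F j in sequentially. \<forall>s\<in>ball s0 1 \<inter> ?A. norm (T j s) \<le> h j"
      using eventually_ge_at_top[of "m + 1"]
    proof eventually_elim
      case (elim j)
      show ?case
      proof
        fix s assume s: "s \<in> ball s0 1 \<inter> ?A"
        let ?z = "s + of_nat (Suc j)"
        have R: "norm (s - 1) \<le> R"
          using s norm_triangle_ineq[of "s0 - 1" "s - s0"] by (simp add: R_def dist_norm norm_minus_commute)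
        have z: "Re ?z \<ge> 2" using s elim by auto
        have "norm (g ?z) \<le> norm (?z - 1) * (C * 2 powr (- Re ?z))"
          using C(2)[OF z] ext[of ?z] z by simp
        also have "2 powr (- Re ?z) \<le> 2 powr real m * (1/2) ^ Suc j"
        proof -
          have "2 powr (- Re ?z) \<le> 2 powr (real m - real (Suc j))" using s by (intro powr_mono) auto
          also have "\<dots> = 2 powr real m * (1/2) ^ Suc j"
            by (simp add: powr_diff powr_realpow power_one_over field_simps del: of_nat_Suc power_Suc)
          finally show ?thesis .
        qed
        finally have "norm (g ?z) \<le> norm (?z - 1) * (C * (2 powr real m * (1/2) ^ Suc j))"
          using C(1) by (simp add: mult_left_mono)
        then have "norm (T j s) \<le> norm (landau_coeff s (Suc j)) * (norm (?z - 1) * (C * (2 powr real m * (1/2) ^ Suc j)))"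
          unfolding T_def norm_mult by (intro mult_left_mono) auto
        also have "\<dots> = norm (landau_coeff s (Suc j) * (s + of_nat (Suc j) - 1)) * (C * (2 powr real m * (1/2) ^ Suc j))"
          by (simp add: norm_mult mult.assoc)
        also have "\<dots> \<le> pochhammer R (Suc (Suc j)) / fact (Suc (Suc j)) * (C * (2 powr real m * (1/2) ^ Suc j))"
          using C(1) by (intro mult_right_mono norm_landau_coeff_le R) auto
        finally show "norm (T j s) \<le> h j" by (simp add: h_def mult_ac del: fact_Suc power_Suc)
      qed
    qed
    ultimately show "\<exists>d h. 0 < d \<and> summable h \<and> (\<forall>\<^sub>F j in sequentially. \<forall>s\<in>ball s0 d \<inter> ?A. norm (T j s) \<le> h j)"
      by (intro exI[of _ 1] exI[of _ h]) auto
  qed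
  then obtain G G' where G: "\<And>s. s \<in> ?A \<Longrightarrow> (\<lambda>j. T j s) sums G s" "\<And>s. s \<in> ?A \<Longrightarrow> (G has_field_derivative G' s) (at s)"
    by blast
  show ?thesis
  proof
    show "(\<lambda>s. 1 - G s) holomorphic_on ?A"
      using G(2) open_A by (intro holomorphic_intros) (auto simp: holomorphic_on_open)
    show "1 - G s = zeta_numerator s" if s: "Re s > 1" for s
    proof -
      have "(\<lambda>j. landau_coeff s (Suc j) * zeta_numerator (s + of_nat (Suc j))) sums
          (1 - landau_coeff s 0 * zeta_numerator s)"
        using landau_identity[OF s] by (subst sums_Suc_iff) simp
      moreover have "landau_coeff s (Suc j) * zeta_numerator (s + of_nat (Suc j)) = T j s" for j
        using s ext[of "s + of_nat (Suc j)"] by (simp add: T_def)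
      ultimately have "(\<lambda>j. T j s) sums (1 - zeta_numerator s)" by (simp add: landau_coeff_def)
      moreover have "(\<lambda>j. T j s) sums G s" using s by (intro G) auto
      ultimately show ?thesis using sums_unique2 by fastforce
    qed
    have "T j 1 = 0" for j by (simp add: T_def landau_coeff_def pochhammer_0_left)
    then have "G 1 = 0" using G(1)[of 1] by (simp add: sums_iff)
    then show "1 - G 1 = 1" by simp
  qed
qed

lemma zeta_numerator_continuation:
  obtains E where "E holomorphic_on UNIV" "\<And>s. Re s > 1 \<Longrightarrow> E s = zeta_numerator s" "E 1 = 1"
proof -
  have "\<exists>g. g holomorphic_on {s. Re s > 1 - real m} \<and> (\<forall>s. Re s > 1 \<longrightarrow> g s = zeta_numerator s) \<and> (m > 0 \<longrightarrow> g 1 = 1)" for m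
  proof (induction m)
    case 0
    show ?case using zeta_numerator_holomorphic by auto
  next
    case (Suc m)
    then obtain g where "g holomorphic_on {s. Re s > 1 - real m}" "\<And>s. Re s > 1 \<Longrightarrow> g s = zeta_numerator s" by auto
    from landau_step[OF this] obtain g' where
      "g' holomorphic_on {s. Re s > - real m}" "\<And>s. Re s > 1 \<Longrightarrow> g' s = zeta_numerator s" "g' 1 = 1" by blast
    then show ?case by (intro exI[of _ g']) auto
  qed
  then obtain g where g: "\<And>m. g m holomorphic_on {s. Re s > 1 - real m}" "\<And>m s. Re s > 1 \<Longrightarrow> g m s = zeta_numerator s"
    "\<And>m. m > 0 \<Longrightarrow> g m 1 = 1"
    by metis
  have agree: "g m s = g m' s" if "m \<le> m'" "Re s > 1 - real m" for m m' s
  proof (rule analytic_continuation_open[where f = "g m" and g = "g m'" and s = "{s. Re s > 1}"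
      and s' = "{s. Re s > 1 - real m}" and z = s])
    show "open {s. 1 < Re s}" "open {s. 1 - real m < Re s}" by (rule open_halfspace_Re_gt)+
    show "{s. 1 < Re s} \<noteq> {}" using complex.sel(1)[of 2 0]
        by (metis (mono_tags) empty_iff mem_Collect_eq one_less_numeral_iff semiring_norm(76))
    show "connected {s. 1 - real m < Re s}" by (intro convex_connected convex_halfspace_Re_gt)
    show "g m' holomorphic_on {s. 1 - real m < Re s}"
      by (rule holomorphic_on_subset[OF g(1)]) (use that in auto)
  qed (use g that in auto)
  \<comment> \<open>An index of a half-plane that contains s; any other choice gives the same value by \<open>agree\<close>.\<close>
  define k where "k s = Suc (nat \<lceil>1 - Re s\<rceil>)" for s
  define E where "E s = g (k s) s" for s
  have k: "Re s > 1 - real (k s)" for s unfolding k_def by linarith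
  have E: "E s = g m s" if "Re s > 1 - real m" for m s
  proof (cases "m \<le> k s")
    case True
    then show ?thesis using agree[OF True that] by (simp only: E_def)
  next
    case False
    then have "k s \<le> m" by simp
    from agree[OF this k] show ?thesis by (simp only: E_def)
  qed
  show ?thesis
  proof
    have "E holomorphic_on (\<Union>m\<in>UNIV. {s. Re s > 1 - real m})"
    proof (rule holomorphic_on_UN_open)
      show "E holomorphic_on {s. Re s > 1 - real m}" for m
        using g(1)[of m] by (rule holomorphic_transform) (simp add: E)
    qed (rule open_halfspace_Re_gt)
    moreover have "(\<Union>m\<in>UNIV. {s. Re s > 1 - real m}) = UNIV" using k by blast
    ultimately show "E holomorphic_on UNIV" by simp
    show "E s = zeta_numerator s" if "Re s > 1" for s using g(2)[OF that] by (simp add: E_def)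
    show "E 1 = 1" by (simp add: E_def g(3) k_def)
  qed
qed

section \<open>The Laurent expansion at 1\<close>

text \<open>
  The function 1 + E(s) / (s - 1) with the continued numerator E satisfies the description of zeta, and
  the identity theorem makes it the only one.  Its residue at 1 is E(1) = 1, so that R, the difference
  quotient of E at 1 plus 1, is entire.
\<close>

lemma zeta_regular_part:
  obtains R where
    "zeta holomorphic_on (- {1})"
    "\<And>s. Re s > 1 \<Longrightarrow> (\<lambda>n. of_nat (Suc n) powr (- s)) sums zeta s"
    "R holomorphic_on UNIV" "\<And>h. h \<noteq> 0 \<Longrightarrow> zeta (1 + h) = 1 / h + R h"
proof -
  obtain E where E: "E holomorphic_on UNIV" "\<And>s. Re s > 1 \<Longrightarrow> E s = zeta_numerator s" "E 1 = 1"
    by (rule zeta_numerator_continuation) auto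
  define P where "P f \<longleftrightarrow> f holomorphic_on (- {1}) \<and>
     (\<forall>s. Re s > 1 \<longrightarrow> (\<lambda>n. of_nat (Suc n) powr (- s)) sums f s) \<and> f 1 = (0 :: complex)" for f
  define z where "z s = (if s = 1 then 0 else 1 + E s / (s - 1))" for s
  have "P z"
    unfolding P_def
  proof (intro conjI allI impI)
    have "(\<lambda>s. 1 + E s / (s - 1)) holomorphic_on (- {1})"
      by (intro holomorphic_intros holomorphic_on_subset[OF E(1)]) auto
    then show "z holomorphic_on (- {1})"
      by (rule holomorphic_transform) (auto simp: z_def)
    show "(\<lambda>n. of_nat (Suc n) powr (- s)) sums z s" if s: "Re s > 1" for s
    proof -
      have "s \<noteq> 1" using s by auto
      then have "z s = 1 + (\<Sum>n. of_nat (n + 2) powr (- s))"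
        using E(2)[OF s] by (simp add: z_def zeta_numerator_def)
      moreover have "(\<lambda>n. of_nat (Suc (Suc n)) powr (- s)) sums (\<Sum>n. of_nat (n + 2) powr (- s) :: complex)"
        using summable_sums[OF summable_complex_powr_shift2[OF s]] by (simp add: add.commute)
      from sums_Suc[of "\<lambda>n. of_nat (Suc n) powr (- s)", OF this]
      have "(\<lambda>n. of_nat (Suc n) powr (- s)) sums ((\<Sum>n. of_nat (n + 2) powr (- s) :: complex) + 1)"
        by simp
      ultimately show ?thesis by (simp add: add.commute)
    qed
    show "z 1 = 0" by (simp add: z_def)
  qed
  have P_hol: "f holomorphic_on (- {1})" and P_at_1: "f 1 = 0"
    and P_sums: "Re s > 1 \<Longrightarrow> (\<lambda>n. of_nat (Suc n) powr (- s)) sums f s" if "P f" for f s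
    using that by (simp_all add: P_def)
  have "f = z" if "P f" for f
  proof
    fix s show "f s = z s"
    proof (cases "s = 1")
      case False
      show ?thesis
      proof (rule analytic_continuation_open[where s = "{s. Re s > 1}" and s' = "- {1}" and f = f and g = z and z = s])
        show "open {s. 1 < Re s}" by (rule open_halfspace_Re_gt)
        show "{s. 1 < Re s} \<noteq> {}" by (auto intro!: exI[of _ 2])
        show "connected (- {1 :: complex})"
          by (rule connected_punctured_universe) simp
        show "f w = z w" if "w \<in> {s. 1 < Re s}" for w
          using sums_unique2[OF P_sums[OF \<open>P f\<close>] P_sums[OF \<open>P z\<close>]] that by simp
        show "{s. 1 < Re s} \<subseteq> - {1}" by auto
        show "f holomorphic_on - {1}" "z holomorphic_on - {1}"
          using P_hol \<open>P f\<close> \<open>P z\<close> by blast+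
        show "s \<in> - {1}" "open (- {1 :: complex})" using False by auto
      qed
    next
      case True
      then show ?thesis using P_at_1[OF \<open>P f\<close>] P_at_1[OF \<open>P z\<close>] by simp
    qed
  qed
  with \<open>P z\<close> have "(THE f. P f) = z" by (rule the_equality)
  then have zeta: "zeta = z" unfolding zeta_def P_def .
  define R where "R h = 1 + (if h = 0 then deriv (\<lambda>h. E (1 + h)) 0 else (E (1 + h) - E (1 + 0)) / (h - 0))" for h
  have "(\<lambda>h. E (1 + h)) holomorphic_on UNIV"
    by (rule holomorphic_on_compose_gen[OF _ E(1), unfolded o_def]) (auto intro!: holomorphic_intros)
  from pole_lemma_open[OF this open_UNIV, of 0] have "R holomorphic_on UNIV"
    unfolding R_def by (intro holomorphic_intros)
  moreover have "zeta (1 + h) = 1 / h + R h" if "h \<noteq> 0" for h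
    using that by (simp add: zeta z_def R_def E(3) diff_divide_distrib)
  ultimately show ?thesis
    using P_hol[OF \<open>P z\<close>] P_sums[OF \<open>P z\<close>] by (intro that[of R]) (simp_all only: zeta)
qed

text \<open>
  Difference quotients along the positive real axis are real, and the reals are closed.
\<close>

lemma real_on_reals_deriv:
  assumes f: "f holomorphic_on UNIV" and real: "\<And>x. x > 0 \<Longrightarrow> f (of_real x) \<in> \<real>"
  shows "(deriv ^^ n) f 0 \<in> \<real>"
proof -
  have real0: "f 0 \<in> \<real>" if f: "f holomorphic_on UNIV" and real: "\<And>x. x > 0 \<Longrightarrow> f (of_real x) \<in> \<real>" for f
  proof -
    have "isCont f 0" using f by (meson UNIV_I continuous_on_eq_continuous_at holomorphic_on_imp_continuous_on open_UNIV)
    moreover have "(\<lambda>n. of_real (1 / real (Suc n)) :: complex) \<longlonglongrightarrow> of_real 0"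
      by (intro tendsto_of_real) (use LIMSEQ_inverse_real_of_nat in \<open>simp add: inverse_eq_divide\<close>)
    ultimately have "(\<lambda>n. f (of_real (1 / real (Suc n)))) \<longlonglongrightarrow> f 0"
      using isCont_tendsto_compose by (metis of_real_0)
    then show ?thesis
      by (rule closed_sequentially[OF closed_complex_Reals, rotated]) (intro real, simp)
  qed
  have step: "deriv f (of_real x) \<in> \<real>"
    if f: "f holomorphic_on UNIV" and real: "\<And>x. x > 0 \<Longrightarrow> f (of_real x) \<in> \<real>" and x: "x > 0" for f x
  proof -
    have "(f has_field_derivative deriv f (of_real x)) (at (of_real x))"
      using f by (intro holomorphic_derivI[OF f open_UNIV]) auto
    then have "((\<lambda>h. (f (of_real x + h) - f (of_real x)) / h) \<longlongrightarrow> deriv f (of_real x)) (at 0)"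
      by (simp add: DERIV_def)
    moreover have "filterlim (\<lambda>n. of_real (1 / real (Suc n)) :: complex) (at 0) sequentially"
    proof (rule filterlim_atI)
      have "(\<lambda>n. of_real (1 / real (Suc n)) :: complex) \<longlonglongrightarrow> of_real 0"
        by (intro tendsto_of_real) (use LIMSEQ_inverse_real_of_nat in \<open>simp add: inverse_eq_divide\<close>)
      then show "(\<lambda>n. of_real (1 / real (Suc n)) :: complex) \<longlonglongrightarrow> 0" by simp
    qed (auto simp del: of_nat_Suc)
    ultimately have lim: "(\<lambda>n. (f (of_real x + of_real (1 / real (Suc n))) - f (of_real x)) / of_real
        (1 / real (Suc n))) \<longlonglongrightarrow> deriv f (of_real x)"
      by (rule filterlim_compose)
    have "(f (of_real x + of_real (1 / real (Suc n))) - f (of_real x)) / of_real (1 / real (Suc n)) \<in> \<real>" for n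
    proof -
      have "f (of_real (x + 1 / real (Suc n))) \<in> \<real>"
        by (rule real) (use x in \<open>simp add: add_pos_pos\<close>)
      then show ?thesis
        unfolding of_real_add by (intro Reals_divide Reals_diff real x) simp_all
    qed
    from closed_sequentially[OF closed_complex_Reals this lim] show ?thesis .
  qed
  have "(deriv ^^ n) f holomorphic_on UNIV \<and> (\<forall>x>0. (deriv ^^ n) f (of_real x) \<in> \<real>)"
  proof (induction n)
    case 0
    show ?case using f real by simp
  next
    case (Suc n)
    then have hol: "(deriv ^^ n) f holomorphic_on UNIV" and re: "\<And>x. x > 0 \<Longrightarrow> (deriv ^^ n) f (of_real x) \<in> \<real>"
      by blast+
    show ?case using holomorphic_deriv[OF hol open_UNIV] step[OF hol re] by simp
  qed
  then have hol: "(deriv ^^ n) f holomorphic_on UNIV" and re: "\<And>x. x > 0 \<Longrightarrow> (deriv ^^ n) f (of_real x) \<in> \<real>"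
    by blast+
  show ?thesis by (rule real0[OF hol re])
qed

text \<open>
  Induction on the order: the constant term is the limit at 0, and dividing the difference by z
  lowers the order by one.
\<close>

lemma coeffs_from_asymptotics:
  fixes f :: "complex \<Rightarrow> complex" and c :: "nat \<Rightarrow> complex"
  assumes "f has_fps_expansion F"
    and "\<And>x. x > 0 \<Longrightarrow> norm (f (of_real x) - (\<Sum>j<n. c j * of_real x ^ j)) \<le> C * x ^ n"
    and "j < n"
  shows "fps_nth F j = c j"
  using assms
proof (induction n arbitrary: f F c j)
  case (Suc n)
  have seq: "(\<lambda>k. of_real (1 / real (Suc k)) :: complex) \<longlonglongrightarrow> 0" and seq': "(\<lambda>k. 1 / real (Suc k)) \<longlonglongrightarrow> 0"
    using LIMSEQ_inverse_real_of_nat tendsto_of_real[OF LIMSEQ_inverse_real_of_nat, where 'a = complex]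
    by (simp_all add: inverse_eq_divide)
  have F0: "fps_nth F 0 = c 0"
  proof -
    have "isCont f 0" by (rule has_fps_expansion_imp_continuous[OF Suc.prems(1)])
    then have "(\<lambda>k. f (of_real (1 / real (Suc k)))) \<longlonglongrightarrow> f 0"
      by (rule isCont_tendsto_compose[OF _ seq])
    moreover have "(\<lambda>k. \<Sum>j<Suc n. c j * of_real (1 / real (Suc k)) ^ j) \<longlonglongrightarrow> (\<Sum>j<Suc n. c j * 0 ^ j)"
      by (intro tendsto_intros seq)
    moreover have "(\<lambda>k. f (of_real (1 / real (Suc k))) - (\<Sum>j<Suc n. c j * of_real (1 / real (Suc k)) ^ j)) \<longlonglongrightarrow> 0"
    proof (rule Lim_null_comparison)
      show "\<forall>\<^sub>F k in sequentially. norm (f (of_real (1 / real (Suc k))) -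
          (\<Sum>j<Suc n. c j * of_real (1 / real (Suc k)) ^ j))
         \<le> C * (1 / real (Suc k)) ^ Suc n"
        by (intro always_eventually allI Suc.prems(2)) simp
      have "(\<lambda>k. C * (1 / real (Suc k)) ^ Suc n) \<longlonglongrightarrow> C * 0 ^ Suc n"
        by (intro tendsto_intros seq')
      then show "(\<lambda>k. C * (1 / real (Suc k)) ^ Suc n) \<longlonglongrightarrow> 0" by simp
    qed
    ultimately have "f 0 - (\<Sum>j<Suc n. c j * 0 ^ j) = 0"
      by (intro LIMSEQ_unique[OF tendsto_diff])
    moreover have "(\<Sum>j<Suc n. c j * 0 ^ j) = c 0" by (subst sum.lessThan_Suc_shift) simp
    ultimately show ?thesis using has_fps_expansion_imp_0_eq_fps_nth_0[OF Suc.prems(1)] by simp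
  qed
  show ?case
  proof (cases j)
    case 0
    then show ?thesis using F0 by simp
  next
    case (Suc i)
    define F1 where "F1 = F - fps_const (c 0)"
    define g where "g = (\<lambda>z. if z = 0 then fps_nth F1 1 else (f z - c 0) / z ^ 1)"
    have F1: "fps_nth F1 0 = 0" by (simp add: F1_def F0)
    have "(\<lambda>z. f z - c 0) has_fps_expansion F1"
      unfolding F1_def by (intro fps_expansion_intros Suc.prems(1))
    then have "g has_fps_expansion fps_shift 1 F1"
    proof (cases "F1 = 0")
      case True
      assume "(\<lambda>z. f z - c 0) has_fps_expansion F1"
      then have "\<forall>\<^sub>F z in nhds 0. eval_fps F1 z = f z - c 0"
        by (simp add: has_fps_expansion_def)
      then have "\<forall>\<^sub>F z in nhds 0. eval_fps (fps_shift 1 F1) z = g z"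
        by eventually_elim (simp add: g_def True)
      then show ?thesis using True by (simp add: has_fps_expansion_def)
    next
      case False
      assume *: "(\<lambda>z. f z - c 0) has_fps_expansion F1"
      have "1 \<le> subdegree F1" using False F1 by (intro subdegree_geI) auto
      from has_fps_expansion_shift[OF * this refl] show ?thesis unfolding g_def .
    qed
    moreover have "norm (g (of_real x) - (\<Sum>j<n. c (Suc j) * of_real x ^ j)) \<le> C * x ^ n" if x: "x > 0" for x
    proof -
      define p where "p = (\<Sum>j<n. c (Suc j) * of_real x ^ j)"
      have "(\<Sum>j<Suc n. c j * of_real x ^ j) = c 0 + of_real x * p"
        unfolding p_def sum.lessThan_Suc_shift by (simp add: sum_distrib_left mult_ac)
      moreover have "f (of_real x) = c 0 + of_real x * g (of_real x)"
        using x by (simp add: g_def)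
      ultimately have "f (of_real x) - (\<Sum>j<Suc n. c j * of_real x ^ j) = of_real x * (g (of_real x) - p)"
        by (simp add: right_diff_distrib)
      then have "x * norm (g (of_real x) - p) \<le> x * (C * x ^ n)"
        using Suc.prems(2)[OF x] x by (simp add: norm_mult mult.left_commute)
      then show ?thesis using x by (simp add: p_def)
    qed
    ultimately have "fps_nth (fps_shift 1 F1) i = c (Suc i)"
      by (rule Suc.IH[where c = "\<lambda>j. c (Suc j)" and f = g]) (use Suc.prems(3) Suc in simp_all)
    then show ?thesis by (simp add: Suc F1_def)
  qed
next
  case 0
  from "0.prems"(3) show ?case by simp
qed

lemma of_nat_powr_real:
  "(of_nat (Suc n) :: complex) powr (- of_real (1 + h)) = of_real (exp (- h * ln (real (Suc n))) / real (Suc n))"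
proof -
  have "(of_nat (Suc n) :: complex) powr (- of_real (1 + h)) = of_real (real (Suc n)) powr (of_real (- (1 + h)))"
    by (simp only: of_real_of_nat_eq of_real_minus)
  also have "\<dots> = of_real (real (Suc n) powr (- (1 + h)))"
    by (rule powr_of_real) auto
  also have "real (Suc n) powr (- (1 + h)) = exp (- h * ln (real (Suc n))) / real (Suc n)"
    by (simp add: powr_def algebra_simps exp_diff exp_minus field_simps del: of_nat_Suc flip: exp_add)
  finally show ?thesis .
qed

text \<open>
  Term by term differentiation; at a real argument all terms are real.
\<close>

lemma
  fixes h :: real
  assumes zeta: "\<And>s. Re s > 1 \<Longrightarrow> (\<lambda>n. of_nat (Suc n) powr (- s)) sums zeta s" and h: "h > 0"
  shows summable_dzeta_reg: "summable (\<lambda>n. ln (real n) / real n * exp (- h * ln (real n)))"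
    and deriv_zeta_eq: "deriv zeta (of_real (1 + h)) = of_real (dzeta_reg h - 1 / h\<^sup>2)"
proof -
  define g where "g n = ln (real n) / real n * exp (- h * ln (real n))" for n :: nat
  let ?s = "complex_of_real (1 + h)"
  obtain Z Z' where Z: "\<And>s. Re s > 1 \<Longrightarrow> (\<lambda>n. of_nat (Suc n) powr (- s)) sums (Z s :: complex)"
    "\<And>s. Re s > 1 \<Longrightarrow> (\<lambda>n. - of_real (ln (Suc n)) * of_nat (Suc n) powr (- s)) sums (Z' s)"
    "\<And>s. Re s > 1 \<Longrightarrow> (Z has_field_derivative Z' s) (at s)" by (rule dirichlet_series_deriv) blast
  have s: "Re ?s > 1" using h by simp
  have "(zeta has_field_derivative Z' ?s) (at ?s)"
  proof (rule has_field_derivative_transform_within_open[OF Z(3)[OF s] open_halfspace_Re_gt[of 1]])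
    show "Z w = zeta w" if "w \<in> {s. 1 < Re s}" for w
      using sums_unique2[OF Z(1) zeta] that by simp
  qed (use s in simp)
  then have d: "deriv zeta ?s = Z' ?s" by (rule DERIV_imp_deriv)
  have "- of_real (ln (Suc n)) * of_nat (Suc n) powr (- ?s) = complex_of_real (- g (Suc n))" for n
    unfolding of_nat_powr_real by (simp add: g_def del: of_nat_Suc)
  with Z(2)[OF s] have sums: "(\<lambda>n. complex_of_real (- g (Suc n))) sums Z' ?s" by simp
  have "(\<lambda>n. - g (Suc n)) sums Re (Z' ?s)" using sums_Re[OF sums] by simp
  from sums_minus[OF this] have "(\<lambda>n. g (Suc n)) sums (- Re (Z' ?s))" by simp
  from sums_Suc[OF this] have "g sums (- Re (Z' ?s) + g 0)" .
  moreover have "g 0 = 0" by (simp add: g_def)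
  ultimately have gs: "g sums (- Re (Z' ?s))" by simp
  show "summable (\<lambda>n. ln (real n) / real n * exp (- h * ln (real n)))"
    using sums_summable[OF gs] unfolding g_def .
  have "Im (Z' ?s) = 0" using sums_Im[OF sums] by (simp add: sums_iff)
  moreover have "dzeta_reg h = 1 / h\<^sup>2 + Re (Z' ?s)"
    using sums_unique[OF gs] unfolding dzeta_reg_def g_def by simp
  ultimately show "deriv zeta ?s = of_real (dzeta_reg h - 1 / h\<^sup>2)"
    unfolding d by (simp add: complex_eq_iff)
qed

text \<open>
  Laurent expansions are unique, so any expansion of the required shape determines the coefficients;
  that the given ones are real is what makes them values of \<open>stieltjes\<close>.
\<close>

lemma stieltjes_eqI:
  assumes "(\<lambda>h. zeta (1 + h)) has_laurent_expansion fls_X_inv + fps_to_fls F" and "\<And>n. fps_nth F n \<in> \<real>"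
  shows "of_real (stieltjes n) = (-1) ^ n * fact n * fps_nth F n"
proof -
  let ?fps = "\<lambda>g. Abs_fps (\<lambda>n. of_real ((-1) ^ n / fact n * g n)) :: complex fps"
  define g0 where "g0 n = (-1) ^ n * fact n * Re (fps_nth F n)" for n
  have F: "fps_nth F n = of_real (Re (fps_nth F n))" for n using assms(2)[of n] by simp
  have g0: "?fps g0 = F"
  proof (rule fps_ext)
    fix n
    have "(-1) ^ n / fact n * g0 n = Re (fps_nth F n)"
      unfolding g0_def by (simp add: field_simps flip: power_mult_distrib)
    then show "fps_nth (?fps g0) n = fps_nth F n" by (simp only: fps_nth_Abs_fps F[of n, symmetric])
  qed
  have "stieltjes = g0"
    unfolding stieltjes_def
  proof (rule the_equality)
    show "(\<lambda>h. zeta (1 + h)) has_laurent_expansion fls_X_inv + fps_to_fls (?fps g0)"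
      unfolding g0 by (rule assms(1))
    fix g assume "(\<lambda>h. zeta (1 + h)) has_laurent_expansion fls_X_inv + fps_to_fls (?fps g)"
    from has_laurent_expansion_unique[OF this assms(1)] have "?fps g = ?fps g0"
      unfolding g0 by simp
    then have "of_real ((-1) ^ n / fact n * g n) = (of_real ((-1) ^ n / fact n * g0 n) :: complex)" for n
      by (simp only: fps_eq_iff fps_nth_Abs_fps)
    then have "(-1) ^ n / fact n * g n = (-1) ^ n / fact n * g0 n" for n
      by (simp only: of_real_eq_iff)
    then show "g = g0" by (simp add: fun_eq_iff)
  qed
  moreover have "complex_of_real (g0 n) = (-1) ^ n * fact n * of_real (Re (fps_nth F n))"
    by (simp add: g0_def)
  ultimately show ?thesis by (simp only: F[of n, symmetric])
qed

text \<open>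
  The derivative of the regular part of zeta at 1 has two descriptions on the positive real axis: its
  power series, and the asymptotic expansion \<open>taylor_dzeta_reg\<close>.
\<close>

lemma stieltjes_eq_stieltjes_lim:
  assumes "j < 3"
  shows "stieltjes (Suc j) = stieltjes_lim (Suc j)"
proof -
  obtain R where hol: "zeta holomorphic_on (- {1})"
    and zeta: "\<And>s. Re s > 1 \<Longrightarrow> (\<lambda>n. of_nat (Suc n) powr (- s)) sums zeta s"
    and R: "R holomorphic_on UNIV" "\<And>h. h \<noteq> 0 \<Longrightarrow> zeta (1 + h) = 1 / h + R h"
    by (rule zeta_regular_part) blast
  define F where "F = fps_expansion R 0"
  have RF: "R has_fps_expansion F"
    unfolding F_def using R(1) by (intro analytic_at_imp_has_fps_expansion_0) (auto simp: analytic_at)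
  have laurent: "(\<lambda>h. zeta (1 + h)) has_laurent_expansion fls_X_inv + fps_to_fls F"
  proof -
    have "(\<lambda>h. inverse h + R h) has_laurent_expansion inverse fls_X + fps_to_fls F"
      by (intro laurent_expansion_intros has_laurent_expansion_fps RF)
    also have "?this \<longleftrightarrow> ?thesis"
    proof (rule has_laurent_expansion_cong)
      have "\<forall>\<^sub>F h in at 0. h \<noteq> (0 :: complex)" by (simp add: eventually_at_filter)
      then show "\<forall>\<^sub>F h in at 0. inverse h + R h = zeta (1 + h)"
        by eventually_elim (simp add: R(2) inverse_eq_divide)
    qed (simp add: fls_inverse_X)
    finally show ?thesis .
  qed
  have "fps_nth F n \<in> \<real>" for n
  proof -
    have "R (of_real x) \<in> \<real>" if x: "x > 0" for x
    proof -
      have "(\<lambda>n. of_nat (Suc n) powr (- of_real (1 + x))) sums zeta (of_real (1 + x))"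
        using x by (intro zeta) simp
      then have "(\<lambda>n. complex_of_real (exp (- x * ln (real (Suc n))) / real (Suc n))) sums zeta (of_real (1 + x))"
        by (simp only: of_nat_powr_real)
      from sums_Im[OF this] have "Im (zeta (of_real (1 + x))) = 0" by (simp add: sums_iff)
      then have "zeta (1 + of_real x) \<in> \<real>" by (simp add: complex_is_Real_iff)
      moreover have "R (of_real x) = zeta (1 + of_real x) - 1 / of_real x" using R(2)[of "of_real x"] x by simp
      ultimately show ?thesis by simp
    qed
    then have "(deriv ^^ n) R 0 \<in> \<real>" by (rule real_on_reals_deriv[OF R(1)])
    moreover have "(fact n :: complex) \<in> \<real>" by (metis of_nat_fact Reals_of_nat)
    ultimately show ?thesis
      unfolding F_def fps_expansion_def fps_nth_Abs_fps by (rule Reals_divide)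
  qed
  note st = stieltjes_eqI[OF laurent this, of "Suc j"]
  have dR: "deriv R (of_real x) = of_real (dzeta_reg x)" if x: "x > 0" for x
  proof -
    have z: "(zeta has_field_derivative deriv zeta (1 + of_real x)) (at (1 + of_real x))"
      using x by (intro holomorphic_derivI[OF hol]) auto
    have "((\<lambda>h. zeta (1 + h) - 1 / h) has_field_derivative
        deriv zeta (1 + of_real x) * 1 - - (1 / (of_real x)\<^sup>2)) (at (of_real x))"
      using x by (intro DERIV_diff DERIV_chain2[where g = "\<lambda>h. 1 + h" and s = UNIV, OF z])
          (auto intro!: derivative_eq_intros simp: power2_eq_square)
    then have "(R has_field_derivative deriv zeta (1 + of_real x) * 1 - - (1 / (of_real x)\<^sup>2)) (at (of_real x))"
      by (rule has_field_derivative_transform_within_open[of _ _ _ "- {0}"]) (use x R(2) in auto)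
    from DERIV_imp_deriv[OF this] show ?thesis
      using deriv_zeta_eq[OF zeta x] by simp
  qed
  have "fps_nth (fps_deriv F) j = of_real (taylor_coeff j)"
  proof (rule coeffs_from_asymptotics[OF _ _ assms])
    show "deriv R has_fps_expansion fps_deriv F" by (rule has_fps_expansion_deriv[OF RF])
    fix x :: real assume x: "x > 0"
    have "\<bar>dzeta_reg x - (\<Sum>j<3. taylor_coeff j * x ^ j)\<bar> \<le> (1 + \<bar>taylor_coeff 3\<bar>) * x ^ 3"
    proof -
      have "\<bar>dzeta_reg x - (taylor_coeff 0 + taylor_coeff 1 * x + taylor_coeff 2 * x\<^sup>2 + taylor_coeff 3 * x ^ 3)\<bar> \<le> x ^ 3"
        by (rule taylor_dzeta_reg[OF x summable_dzeta_reg[OF zeta x]])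
      moreover have "\<bar>taylor_coeff 3 * x ^ 3\<bar> = \<bar>taylor_coeff 3\<bar> * x ^ 3" using x by (simp add: abs_mult)
      moreover have "(\<Sum>j<3. taylor_coeff j * x ^ j) = taylor_coeff 0 + taylor_coeff 1 * x + taylor_coeff 2 * x\<^sup>2"
        by (simp add: eval_nat_numeral)
      ultimately show ?thesis unfolding distrib_right by linarith
    qed
    moreover have "deriv R (of_real x) - (\<Sum>j<3. of_real (taylor_coeff j) * of_real x ^ j)
        = complex_of_real (dzeta_reg x - (\<Sum>j<3. taylor_coeff j * x ^ j))"
      using dR[OF x] by simp
    ultimately show "norm (deriv R (of_real x) - (\<Sum>j<3. of_real (taylor_coeff j) * of_real x ^ j))
        \<le> (1 + \<bar>taylor_coeff 3\<bar>) * x ^ 3"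
      by (simp only: norm_of_real)
  qed
  then have "of_nat (Suc j) * fps_nth F (Suc j) = of_real (taylor_coeff j)"
    by (simp del: of_nat_Suc)
  then have "complex_of_real (stieltjes (Suc j)) = of_real ((-1) ^ Suc j * fact j * taylor_coeff j)"
    using st by (simp add: fact_Suc mult_ac del: of_nat_Suc)
  then have "stieltjes (Suc j) = (-1) ^ Suc j * fact j * taylor_coeff j"
    by (simp only: of_real_eq_iff)
  also have "\<dots> = stieltjes_lim (Suc j)"
    by (simp add: taylor_coeff_def flip: power_mult_distrib)
  finally show ?thesis .
qed

section \<open>The inequality\<close>

theorem theorem6:
  fixes \<alpha> \<beta> \<delta> s :: real
  assumes "\<alpha> = - stieltjes 1"
    and "\<beta> = stieltjes 2 / stieltjes 1"
    and "\<delta> = (stieltjes 2 / stieltjes 1)\<^sup>2 - stieltjes 3 / (2 * stieltjes 1)"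
    and "s > 1"
  shows "\<alpha> / (1 + \<beta> * (s - 1) + \<alpha> * (s - 1)\<^sup>2)
           < Re (deriv zeta (complex_of_real s)) + 1 / (s - 1)\<^sup>2 \<and>
         Re (deriv zeta (complex_of_real s)) + 1 / (s - 1)\<^sup>2
           < \<alpha> / (1 + \<beta> * (s - 1) + \<delta> * (s - 1)\<^sup>2)"
proof -
  have stieltjes_lim: "stieltjes 1 = stieltjes_lim 1" "stieltjes 2 = stieltjes_lim 2" "stieltjes 3 = stieltjes_lim 3"
    using stieltjes_eq_stieltjes_lim[of 0] stieltjes_eq_stieltjes_lim[of 1] stieltjes_eq_stieltjes_lim[of 2]
        by (simp_all add: eval_nat_numeral)
  interpret stieltjes_params \<alpha> \<beta> \<delta>
    by unfold_locales (simp_all only: assms stieltjes_lim)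
  obtain R where zeta: "\<And>s. Re s > 1 \<Longrightarrow> (\<lambda>n. of_nat (Suc n) powr (- s)) sums zeta s"
    by (rule zeta_regular_part) blast
  have h: "s - 1 > 0" using assms(4) by simp
  have "Re (deriv zeta (complex_of_real s)) + 1 / (s - 1)\<^sup>2 = dzeta_reg (s - 1)"
    using deriv_zeta_eq[OF zeta h] by simp
  then show ?thesis
    using dzeta_reg_bounds[OF h summable_dzeta_reg[OF zeta h]] by simp
qed

end
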